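(* Let $F=f=\frac1n\sum_{i=1}^nf_i$ on $\mathbb{R}^d$, where each $f_i$ is convex with $L$-Lipschitz continuous gradient, and let $x^*$ be a minimizer of $F$. Suppose the step size $\gamma$ in the ASVRG algorithm described in the context (epoch length $m=2n$, lock-free reads with delay bound $\tau$) satisfies $$\gamma\le\min\left\{\frac{(\sqrt5-\sqrt2)\sqrt2}{20\cdot5^{3/4}\sqrt e(\sqrt e-1)\,\tau L},\ \frac{1}{12\sqrt5\,e(e-1)\,\tau^2L}\right\}.$$ Then $$\mathbb{E}\big(F(\tilde x^{s+1})-F(x^* )\big)\le\big(F(x^0_0)-F(x^* )\big)+\frac{9}{16\gamma m}\|x^0_0-x^*\|^2 .$$
   Context: Norms are Euclidean. $L$-Lipschitz continuous gradient: $\|\nabla f_i(x)-\nabla f_i(y)\|\le L\|x-y\|$ for all $x,y$. Here $e$ is Euler's number, superscript $s$ is the epoch index and subscript $k$ the inner iteration index; $\mathbb{E}$ is the expectation over all random numbers. ASVRG algorithm. Input $x^0_0$; $m=2n$, $\tilde x^0=x^0_0$, step size $\gamma$. For $s=0,\dots,S-1$: for $k=0,\dots,m-1$, randomly sample $i_{k,s}$ from $\{1,\dots,n\}$ and set $$v^s_{j(k)}=\tilde\nabla f(x^s_{j(k)})=\nabla f_{i_{k,s}}(x^s_{j(k)})-\nabla f_{i_{k,s}}(\tilde x^s)+\frac1n\sum_{i=1}^n\nabla f_i(\tilde x^s),\qquad x^s_{k+1}=x^s_k-\gamma\,v^s_{j(k)} .$$ At the end of the epoch, $x^{s+1}_0=\frac1m\sum_{k=1}^mx^s_k$,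 and the snapshot $\tilde x^{s+1}$ is this same average. Lock-free ("wild", inconsistent read) scheme with bounded delay $\tau$: the point $x^s_{j(k)}$ read at inner iteration $k$ need not be an actual past iterate; different coordinates may come from different iterations, and updates older than the last $\tau$ have been completed: $$x^s_{j(k)}=x^s_k+\gamma\sum_{l=\max(0,k-\tau)}^{k-1}I^s_{k(l)}\big(v^s_{j(l)}\big),$$ where $I^s_{k(l)}:\mathbb{R}^d\to\mathbb{R}^d$ acts coordinatewise: its $p$-th coordinate is $0$ if $v^s_{j(l)}(p)$ has already been written into $x$ at the read step of iteration $k$, and $v^s_{j(l)}(p)$ otherwise. *)

theory Defs
  imports "HOL-Probability.Probability"
begin

definition average :: "nat \<Rightarrow> (nat \<Rightarrow> 'a::real_vector) \<Rightarrow> 'a" where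
  "average n a = (\<Sum>i = 1..n. a i) /\<^sub>R real n"

definition svrg_gradient ::
  "nat \<Rightarrow> (nat \<Rightarrow> 'a::real_vector \<Rightarrow> 'a) \<Rightarrow> 'a \<Rightarrow> nat \<Rightarrow> 'a \<Rightarrow> 'a" where
  "svrg_gradient n g z i y = g i y - g i z + average n (\<lambda>j. g j z)"

text \<open>The coordinatewise operator $I$ of the inconsistent read: \<open>U\<close> is the set of coordinates of
  the update that have not yet been written at the time of the read.\<close>

definition unwritten_part :: "'d set \<Rightarrow> real ^ 'd \<Rightarrow> real ^ 'd" where
  "unwritten_part U v = (\<chi> p. if p \<in> U then v $ p else 0)"

text \<open>
  The equations satisfied by one run (one outcome of the randomness) of the lock-free algorithm
  with \<open>S\<close> epochs of \<open>m\<close> inner iterations. Here \<open>ind s k\<close> is the index sampled at inner iteration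
  \<open>k\<close> of epoch \<open>s\<close>, and \<open>U s k l\<close> the set of coordinates of update \<open>l\<close> still unwritten when
  iteration \<open>k\<close> of epoch \<open>s\<close> reads. Further, \<open>x s k\<close> is the iterate, \<open>xr s k\<close> the point that is
  read, \<open>v s k\<close> the update direction and \<open>xt s\<close> the snapshot.
  Subtraction on \<^typ>\<open>nat\<close> truncates, so \<open>k - \<tau>\<close> is the maximum of $0$ and $k - \tau$.
\<close>

definition asvrg_run ::
  "nat \<Rightarrow> (nat \<Rightarrow> real ^ 'd \<Rightarrow> real ^ 'd) \<Rightarrow> real \<Rightarrow> nat \<Rightarrow> nat \<Rightarrow> nat \<Rightarrow> real ^ 'd \<Rightarrow>
   (nat \<Rightarrow> nat \<Rightarrow> nat) \<Rightarrow> (nat \<Rightarrow> nat \<Rightarrow> nat \<Rightarrow> 'd set) \<Rightarrow>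
   (nat \<Rightarrow> nat \<Rightarrow> real ^ 'd) \<Rightarrow> (nat \<Rightarrow> nat \<Rightarrow> real ^ 'd) \<Rightarrow> (nat \<Rightarrow> nat \<Rightarrow> real ^ 'd) \<Rightarrow>
   (nat \<Rightarrow> real ^ 'd) \<Rightarrow> bool" where
  "asvrg_run n g \<gamma> \<tau> m S x00 ind U x xr v xt \<longleftrightarrow>
     x 0 0 = x00 \<and> xt 0 = x00 \<and>
     (\<forall>s<S.
        (\<forall>k<m.
           xr s k = x s k + \<gamma> *\<^sub>R (\<Sum>l = k - \<tau>..<k. unwritten_part (U s k l) (v s l)) \<and>
           v s k = svrg_gradient n g (xt s) (ind s k) (xr s k) \<and>
           x s (Suc k) = x s k - \<gamma> *\<^sub>R v s k) \<and>
        x (Suc s) 0 = average m (x s) \<and>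
        xt (Suc s) = average m (x s))"

text \<open>
  The sampling model. The \<open>\<sigma>\<close>-algebra \<open>H s k\<close> is the information available just before index
  \<open>k\<close> of epoch \<open>s\<close> is drawn: it contains all indices drawn earlier and the read patterns up to and
  including that of iteration \<open>k\<close>. Each index is uniform on \<open>{1..n}\<close> and independent of this past,
  which is what makes \<open>svrg_gradient\<close> at the read point a conditionally unbiased gradient estimate.
  The read patterns are otherwise arbitrary: deterministic, random, or dependent on the past.
\<close>

definition asvrg_sampling ::
  "'w measure \<Rightarrow> (nat \<Rightarrow> nat \<Rightarrow> 'w measure) \<Rightarrow> nat \<Rightarrow> nat \<Rightarrow> nat \<Rightarrow> nat \<Rightarrow>
   (nat \<Rightarrow> nat \<Rightarrow> 'w \<Rightarrow> nat) \<Rightarrow> (nat \<Rightarrow> nat \<Rightarrow> nat \<Rightarrow> 'w \<Rightarrow> 'd set) \<Rightarrow> bool" where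
  "asvrg_sampling M H n \<tau> m S ind U \<longleftrightarrow>
     (\<forall>s<S. \<forall>k<m.
        subalgebra M (H s k) \<and>
        (\<forall>s'<S. \<forall>k'<m. s' < s \<or> s' = s \<and> k' < k \<longrightarrow>
           ind s' k' \<in> H s k \<rightarrow>\<^sub>M count_space {1..n}) \<and>
        (\<forall>s'<S. \<forall>k'<m. s' < s \<or> s' = s \<and> k' \<le> k \<longrightarrow>
           (\<forall>l \<in> {k' - \<tau>..<k'}. \<forall>p. {\<omega> \<in> space M. p \<in> U s' k' l \<omega>} \<in> sets (H s k))) \<and>
        ind s k \<in> M \<rightarrow>\<^sub>M count_space {1..n} \<and>
        distr M (count_space {1..n}) (ind s k) = uniform_count_measure {1..n} \<and>
        prob_space.indep_set M (sets (H s k))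
          (sets (vimage_algebra (space M) (ind s k) (count_space {1..n}))))"

end

theory Submission
  imports Defs
begin

text \<open>
  Within an epoch write \<open>p\<^sub>k\<close> for the expected optimality gap at the iterate \<open>x\<^sub>k\<close> and \<open>P\<close> for the gap
  at the snapshot. Tangent and descent inequality bound $\langle \nabla F(\hat x_k), x_k - u\rangle$ at
  the read point $\hat x_k$ from below by $F(x_k) - F(u)$ minus a multiple of
  $\|x_k - \hat x_k\|^2$, so the delay only adds a second-order error. Summed over the epoch it is
  absorbed since $\gamma L\tau^2 \le 1/100$, and the total noise is at most
  $\frac{\gamma}{15}(\sum_k p_k + mP)$.

  The next epoch starts from the average of the iterates, so $\|x - x^*\|^2$ is averaged over the
  epoch and late gaps \<open>p\<^sub>k\<close> hardly decrease it. Taking the iterate \<open>x\<^sub>j\<close> itself as the comparison point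
  \<open>u\<close> shows that late gaps do not exceed earlier ones by more than the noise. Hence
  $\frac{1}{2\gamma m}\|x - x^*\|^2 + \frac{1}{10}(F(x) - F(x^*))$ does not increase in expectation
  from one snapshot to the next, and 21/20 of it bounds the gap one epoch later.

  Every random variable of the algorithm takes finitely many values, so measurability and
  integrability reduce to facts on simple functions.
\<close>

subsection \<open>Averages\<close>

lemma average_cong: "(\<And>i. i \<in> {1..n} \<Longrightarrow> a i = b i) \<Longrightarrow> average n a = average n b"
  by (auto simp: average_def)

lemma average_add: "average n (\<lambda>i. a i + b i) = average n a + average n b"
  by (simp add: average_def sum.distrib scaleR_add_right)

lemma average_diff: "average n (\<lambda>i. a i - b i) = average n a - average n b"
  by (simp add: average_def sum_subtractf scaleR_diff_right)

lemma average_mult: "average n (\<lambda>i. c * a i) = c * average n a" for c :: real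
  by (simp add: average_def sum_distrib_left[symmetric])

lemma average_inner_left: "average n (\<lambda>i. inner (a i) b) = inner (average n a) b"
  by (simp add: average_def inner_sum_left)

lemma average_inner_right: "average n (\<lambda>i. inner b (a i)) = inner b (average n a)"
  by (simp add: average_def inner_sum_right)

lemma average_const: "n \<ge> 1 \<Longrightarrow> average n (\<lambda>_. c) = c"
  by (simp add: average_def sum_constant_scaleR)

lemma mult_average: "n \<ge> 1 \<Longrightarrow> real n * average n a = (\<Sum>i = 1..n. a i)"
  by (simp add: average_def)

lemma average_mono:
  fixes a b :: "nat \<Rightarrow> real"
  shows "(\<And>i. i \<in> {1..n} \<Longrightarrow> a i \<le> b i) \<Longrightarrow> average n a \<le> average n b"
  by (auto simp: average_def intro!: mult_left_mono sum_mono)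

lemma average_nonneg:
  fixes a :: "nat \<Rightarrow> real"
  shows "(\<And>i. i \<in> {1..n} \<Longrightarrow> 0 \<le> a i) \<Longrightarrow> 0 \<le> average n a"
  by (auto simp: average_def intro!: mult_nonneg_nonneg sum_nonneg)

lemma norm_average_le: "norm (average n a) \<le> average n (\<lambda>i. norm (a i))"
  for a :: "nat \<Rightarrow> 'a::real_normed_vector"
  by (auto simp: average_def intro!: mult_left_mono norm_sum)

lemma average_norm_sq_shift:
  fixes a :: "nat \<Rightarrow> 'a::real_inner"
  assumes "n \<ge> 1"
  shows "average n (\<lambda>i. (norm (a i + c))\<^sup>2) =
    average n (\<lambda>i. (norm (a i))\<^sup>2) + 2 * inner (average n a) c + (norm c)\<^sup>2"
proof -
  have "(norm (a i + c))\<^sup>2 = (norm (a i))\<^sup>2 + 2 * inner (a i) c + (norm c)\<^sup>2" for i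
    by (simp add: power2_norm_eq_inner inner_add_left inner_add_right inner_commute)
  then show ?thesis
    by (simp add: average_add average_mult average_inner_left average_const[OF assms])
qed

text \<open>The variance identity, obtained by shifting by minus the mean. It later lets the
  snapshot correction in the gradient estimate lose its mean at no cost.\<close>

lemma average_norm_sq_centered:
  fixes a :: "nat \<Rightarrow> 'a::real_inner"
  assumes "n \<ge> 1"
  shows "average n (\<lambda>i. (norm (a i - average n a))\<^sup>2) =
    average n (\<lambda>i. (norm (a i))\<^sup>2) - (norm (average n a))\<^sup>2"
  using average_norm_sq_shift[OF assms, of a "- average n a"]
  by (simp add: power2_norm_eq_inner)

text \<open>Jensen's inequality for the squared norm: the variance is nonnegative.\<close>

lemma norm_sq_average_le:
  fixes a :: "nat \<Rightarrow> 'a::real_inner"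
  assumes "n \<ge> 1"
  shows "(norm (average n a))\<^sup>2 \<le> average n (\<lambda>i. (norm (a i))\<^sup>2)"
  using average_norm_sq_centered[OF assms, of a]
    average_nonneg[of n "\<lambda>i. (norm (a i - average n a))\<^sup>2"] by simp

lemma norm_sq_sum_le:
  fixes a :: "'b \<Rightarrow> 'a::real_inner"
  assumes "finite A"
  shows "(norm (\<Sum>i\<in>A. a i))\<^sup>2 \<le> real (card A) * (\<Sum>i\<in>A. (norm (a i))\<^sup>2)"
proof -
  have "(norm (\<Sum>i\<in>A. a i))\<^sup>2 \<le> (\<Sum>i\<in>A. norm (a i))\<^sup>2"
    by (intro power_mono norm_sum) simp
  also have "\<dots> \<le> (\<Sum>i\<in>A. (norm (a i))\<^sup>2) * (\<Sum>i\<in>A. 1\<^sup>2)"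
    using Cauchy_Schwarz_ineq_sum[of "\<lambda>i. norm (a i)" "\<lambda>_. 1" A] by simp
  finally show ?thesis
    by (simp add: mult.commute)
qed

lemma norm_sq_add3_le:
  fixes a b c :: "'a::real_inner"
  shows "(norm (a + b + c))\<^sup>2 \<le> 3 * (norm a)\<^sup>2 + 3 * (norm b)\<^sup>2 + 3 * (norm c)\<^sup>2"
proof -
  \<comment> \<open>Nonnegativity of the pairwise differences bounds the mixed terms by twice the
    sum of the squares.\<close>
  have "0 \<le> (norm (a - b))\<^sup>2 + (norm (b - c))\<^sup>2 + (norm (a - c))\<^sup>2" by simp
  then show ?thesis
    unfolding power2_norm_eq_inner
    by (simp add: inner_diff_left inner_diff_right inner_add_left inner_add_right inner_commute)
qed

subsection \<open>Smooth convex functions\<close>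

locale smooth_convex =
  fixes f :: "'a::real_inner \<Rightarrow> real" and g :: "'a \<Rightarrow> 'a" and L :: real
  assumes convex: "convex_on UNIV f"
    and gderiv: "GDERIV f y :> g y"
    and lipschitz: "L-lipschitz_on UNIV g"
    and L_pos: "L > 0"
begin

text \<open>Restriction to a line turns the tangent and descent inequalities into statements about
  one real variable.\<close>

lemma deriv_along_line: "((\<lambda>t. f (y + t *\<^sub>R d)) has_real_derivative inner (g (y + t *\<^sub>R d)) d) (at t within A)"
proof -
  have "(f has_derivative (\<lambda>h. inner h (g (y + t *\<^sub>R d)))) (at (y + t *\<^sub>R d))"
    using gderiv by (simp add: gderiv_def)
  then have "((\<lambda>t. f (y + t *\<^sub>R d)) has_derivative (\<lambda>h. inner (h *\<^sub>R d) (g (y + t *\<^sub>R d)))) (at t within A)"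
    by (rule has_derivative_compose[rotated]) (auto intro!: derivative_eq_intros)
  then show ?thesis
    by (simp add: has_field_derivative_def inner_commute mult.commute[of _ "inner _ _"])
qed

text \<open>A convex function of one variable lies above its tangent. This is applied on the line
  through \<open>y\<close> and \<open>z\<close>, touching at t = 0 and evaluating at t = 1.\<close>

lemma tangent_le: "f y + inner (g y) (z - y) \<le> f z"
proof -
  define \<phi> where "\<phi> t = f (y + t *\<^sub>R (z - y))" for t
  have "convex_on UNIV \<phi>"
  proof (rule convex_onI)
    fix t a b :: real assume "0 < t" "t < 1"
    then have "f ((1 - t) *\<^sub>R (y + a *\<^sub>R (z - y)) + t *\<^sub>R (y + b *\<^sub>R (z - y)))
        \<le> (1 - t) * \<phi> a + t * \<phi> b"
      using convex unfolding \<phi>_def by (intro convex_onD) auto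
    also have "(1 - t) *\<^sub>R (y + a *\<^sub>R (z - y)) + t *\<^sub>R (y + b *\<^sub>R (z - y)) =
        y + ((1 - t) *\<^sub>R a + t *\<^sub>R b) *\<^sub>R (z - y)"
      by (simp add: algebra_simps)
    finally show "\<phi> ((1 - t) *\<^sub>R a + t *\<^sub>R b) \<le> (1 - t) * \<phi> a + t * \<phi> b"
      by (simp add: \<phi>_def)
  qed auto
  moreover have "(\<phi> has_real_derivative inner (g y) (z - y)) (at 0)"
    using deriv_along_line[of y "z - y" 0 UNIV] unfolding \<phi>_def by simp
  ultimately have "\<phi> 1 - \<phi> 0 \<ge> inner (g y) (z - y) * (1 - 0)"
    by (intro convex_on_imp_above_tangent) auto
  then show ?thesis
    by (simp add: \<phi>_def)
qed

lemma norm_grad_diff_le: "norm (g y - g z) \<le> L * norm (y - z)"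
  using lipschitz_on_normD[OF lipschitz] by simp

lemma descent: "f z \<le> f y + inner (g y) (z - y) + L / 2 * (norm (z - y))\<^sup>2"
proof -
  define d where "d = z - y"
  \<comment> \<open>Up to the constant \<open>f y\<close>, this is \<open>f\<close> along the
    segment minus its claimed quadratic upper bound. The Lipschitz condition makes the derivative
    nonpositive.\<close>
  define \<phi> where "\<phi> t = f (y + t *\<^sub>R d) - t * inner (g y) d - L / 2 * t\<^sup>2 * (norm d)\<^sup>2" for t
  have "\<phi> 1 \<le> \<phi> 0"
  proof (rule DERIV_nonpos_imp_nonincreasing[of 0 1 \<phi>])
    fix t :: real assume "0 \<le> t" "t \<le> 1"
    have "(\<phi> has_real_derivative inner (g (y + t *\<^sub>R d)) d - inner (g y) d - L * t * (norm d)\<^sup>2) (at t)"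
      unfolding \<phi>_def by (auto intro!: derivative_eq_intros deriv_along_line)
    moreover have "inner (g (y + t *\<^sub>R d) - g y) d \<le> norm (g (y + t *\<^sub>R d) - g y) * norm d"
      by (rule norm_cauchy_schwarz)
    moreover have "norm (g (y + t *\<^sub>R d) - g y) * norm d \<le> L * t * (norm d)\<^sup>2"
      using mult_right_mono[OF norm_grad_diff_le[of "y + t *\<^sub>R d" y], of "norm d"] \<open>0 \<le> t\<close>
      by (simp add: power2_eq_square mult.assoc)
    ultimately show "\<exists>D. (\<phi> has_real_derivative D) (at t) \<and> D \<le> 0"
      by (intro exI conjI) (auto simp: inner_diff_left)
  qed simp
  then show ?thesis
    by (simp add: \<phi>_def d_def)
qed

text \<open>The tangent inequality for \<open>u \<mapsto> f u - inner (g z) u\<close>, minimal at \<open>z\<close>, is compared with the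
  descent bound at the gradient step from \<open>y\<close>.\<close>

lemma norm_grad_diff_sq_le: "(norm (g y - g z))\<^sup>2 \<le> 2 * L * (f y - f z - inner (g z) (y - z))"
proof -
  define \<Delta> where "\<Delta> = g y - g z"
  define w where "w = y - (1 / L) *\<^sub>R \<Delta>"
  have 1: "f z + inner (g z) (w - z) \<le> f w"
    by (rule tangent_le)
  have 2: "f w \<le> f y + inner (g y) (w - y) + L / 2 * (norm (w - y))\<^sup>2"
    by (rule descent)
  have wy: "w - y = - ((1 / L) *\<^sub>R \<Delta>)"
    by (simp add: w_def)
  have 3: "L / 2 * (norm (w - y))\<^sup>2 = (norm \<Delta>)\<^sup>2 / (2 * L)"
    using L_pos by (simp add: wy power_mult_distrib power2_eq_square field_simps)
  have 4: "inner \<Delta> (w - y) = - ((norm \<Delta>)\<^sup>2 / L)"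
    by (simp add: wy power2_norm_eq_inner)
  have 5: "inner \<Delta> (w - y) = inner (g y) (w - y) - (inner (g z) (w - z) - inner (g z) (y - z))"
    by (simp add: \<Delta>_def inner_diff_left inner_diff_right)
  have "(norm \<Delta>)\<^sup>2 / L - (norm \<Delta>)\<^sup>2 / (2 * L) \<le> f y - f z - inner (g z) (y - z)"
    using 1 2 3 4 5 by linarith
  then show ?thesis
    using L_pos by (simp add: \<Delta>_def field_simps)
qed

end

subsection \<open>One step of the variance-reduced gradient method\<close>

locale finite_sum =
  fixes n :: nat and f :: "nat \<Rightarrow> 'a::real_inner \<Rightarrow> real" and g :: "nat \<Rightarrow> 'a \<Rightarrow> 'a"
    and F :: "'a \<Rightarrow> real" and L :: real and xstar :: 'a
  assumes n_pos: "n \<ge> 1" and L_pos: "L > 0"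
    and F_eq: "F y = average n (\<lambda>i. f i y)"
    and component: "i \<in> {1..n} \<Longrightarrow> smooth_convex (f i) (g i) L"
    and minimizer: "F xstar \<le> F y"
begin

definition G :: "'a \<Rightarrow> 'a" where "G y = average n (\<lambda>i. g i y)"

lemma F_tangent_le: "F y + inner (G y) (z - y) \<le> F z"
proof -
  have "average n (\<lambda>i. f i y + inner (g i y) (z - y)) \<le> average n (\<lambda>i. f i z)"
    by (intro average_mono smooth_convex.tangent_le[OF component])
  then show ?thesis
    by (simp add: average_add average_inner_left F_eq G_def)
qed

lemma F_descent: "F z \<le> F y + inner (G y) (z - y) + L / 2 * (norm (z - y))\<^sup>2"
proof -
  have "average n (\<lambda>i. f i z) \<le>
      average n (\<lambda>i. f i y + inner (g i y) (z - y) + L / 2 * (norm (z - y))\<^sup>2)"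
    by (intro average_mono smooth_convex.descent[OF component])
  then show ?thesis
    by (simp add: average_add average_inner_left average_const[OF n_pos] F_eq G_def)
qed

lemma norm_G_diff_le: "norm (G y - G z) \<le> L * norm (y - z)"
proof -
  have "norm (G y - G z) \<le> average n (\<lambda>i. norm (g i y - g i z))"
    unfolding G_def average_diff[symmetric] by (rule norm_average_le)
  also have "\<dots> \<le> average n (\<lambda>i. L * norm (y - z))"
    by (intro average_mono smooth_convex.norm_grad_diff_le[OF component])
  finally show ?thesis
    by (simp add: average_const[OF n_pos])
qed

text \<open>Minimality is given through function values, so stationarity is derived: a gradient step
  of length 1/L from \<open>xstar\<close> would lower \<open>F\<close> by the squared gradient norm
  over 2L.\<close>

lemma G_xstar: "G xstar = 0"
proof -
  define w where "w = xstar - (1 / L) *\<^sub>R G xstar"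
  have "F xstar \<le> F xstar + inner (G xstar) (w - xstar) + L / 2 * (norm (w - xstar))\<^sup>2"
    using minimizer F_descent order_trans by blast
  moreover have "inner (G xstar) (w - xstar) = - ((norm (G xstar))\<^sup>2 / L)"
    by (simp add: w_def power2_norm_eq_inner)
  moreover have "L / 2 * (norm (w - xstar))\<^sup>2 = (norm (G xstar))\<^sup>2 / (2 * L)"
    using L_pos by (simp add: w_def power_mult_distrib power2_eq_square field_simps)
  ultimately have "(norm (G xstar))\<^sup>2 / L \<le> (norm (G xstar))\<^sup>2 / (2 * L)"
    by linarith
  then have "(norm (G xstar))\<^sup>2 \<le> 0"
    using L_pos by (simp add: field_simps)
  then show ?thesis by simp
qed

text \<open>Each component contributes its Bregman gap at \<open>xstar\<close>. The linear terms
  average to \<open>G xstar = 0\<close>, which leaves the optimality gap of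
  \<open>F\<close>.\<close>

lemma average_norm_grad_diff_sq_le:
  "average n (\<lambda>i. (norm (g i y - g i xstar))\<^sup>2) \<le> 2 * L * (F y - F xstar)"
proof -
  have "average n (\<lambda>i. (norm (g i y - g i xstar))\<^sup>2) \<le>
      average n (\<lambda>i. 2 * L * (f i y - f i xstar - inner (g i xstar) (y - xstar)))"
    by (intro average_mono smooth_convex.norm_grad_diff_sq_le[OF component])
  also have "\<dots> = 2 * L * (F y - F xstar)"
    using G_xstar unfolding average_mult average_diff average_inner_left F_eq[symmetric]
    by (simp add: G_def)
  finally show ?thesis .
qed

text \<open>Unbiasedness: averaged over the index, the component gradients at the snapshot cancel
  against the full gradient there.\<close>

lemma average_svrg_gradient: "average n (\<lambda>i. svrg_gradient n g z i y) = G y"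
  by (simp add: svrg_gradient_def average_add average_diff average_const[OF n_pos] G_def)

text \<open>Jensen's inequality for \<open>F\<close>: in the tangent inequalities at the average,
  the linear terms sum to zero.\<close>

lemma F_average_le: "k \<ge> 1 \<Longrightarrow> F (average k a) \<le> average k (\<lambda>i. F (a i))"
proof -
  assume k: "k \<ge> 1"
  let ?c = "average k a"
  have "average k (\<lambda>i. F ?c + inner (G ?c) (a i - ?c)) \<le> average k (\<lambda>i. F (a i))"
    by (intro average_mono F_tangent_le)
  then show ?thesis
    by (simp add: average_add average_inner_right average_diff average_const[OF k])
qed

text \<open>Here \<open>y\<close> is the iterate, \<open>r\<close> the read point and
  \<open>z\<close> the snapshot. The estimate splits into the effect of the read error, the distance
  of the iterate from optimality, and a centered snapshot term.\<close>

lemma average_norm_svrg_gradient_sq_le: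
  "average n (\<lambda>i. (norm (svrg_gradient n g z i r))\<^sup>2) \<le>
    3 * L\<^sup>2 * (norm (y - r))\<^sup>2 + 6 * L * ((F y - F xstar) + (F z - F xstar))"
proof -
  define b where "b = (\<lambda>i. g i xstar - g i z)"
  have b: "average n b = - G z"
    using G_xstar by (simp add: b_def average_diff G_def)
  have "average n (\<lambda>i. (norm (svrg_gradient n g z i r))\<^sup>2) \<le>
      average n (\<lambda>i. 3 * (norm (g i r - g i y))\<^sup>2 + 3 * (norm (g i y - g i xstar))\<^sup>2
        + 3 * (norm (b i - average n b))\<^sup>2)"
  proof (rule average_mono)
    fix i
    have "svrg_gradient n g z i r = (g i r - g i y) + (g i y - g i xstar) + (b i - average n b)"
      by (simp add: svrg_gradient_def b) (simp add: b_def G_def)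
    then show "(norm (svrg_gradient n g z i r))\<^sup>2 \<le> 3 * (norm (g i r - g i y))\<^sup>2
        + 3 * (norm (g i y - g i xstar))\<^sup>2 + 3 * (norm (b i - average n b))\<^sup>2"
      using norm_sq_add3_le by metis
  qed
  also have "\<dots> = 3 * average n (\<lambda>i. (norm (g i r - g i y))\<^sup>2)
      + 3 * average n (\<lambda>i. (norm (g i y - g i xstar))\<^sup>2)
      + 3 * average n (\<lambda>i. (norm (b i - average n b))\<^sup>2)"
    by (simp add: average_add average_mult)
  also have "average n (\<lambda>i. (norm (g i r - g i y))\<^sup>2) \<le> average n (\<lambda>i. L\<^sup>2 * (norm (y - r))\<^sup>2)"
  proof (rule average_mono)
    fix i assume "i \<in> {1..n}"
    then have "norm (g i r - g i y) \<le> L * norm (r - y)"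
      by (intro smooth_convex.norm_grad_diff_le[OF component])
    from power_mono[OF this, of 2] show "(norm (g i r - g i y))\<^sup>2 \<le> L\<^sup>2 * (norm (y - r))\<^sup>2"
      by (simp add: power_mult_distrib norm_minus_commute)
  qed
  also have "average n (\<lambda>i. (norm (g i y - g i xstar))\<^sup>2) \<le> 2 * L * (F y - F xstar)"
    by (rule average_norm_grad_diff_sq_le)
  also have "average n (\<lambda>i. (norm (b i - average n b))\<^sup>2) \<le> 2 * L * (F z - F xstar)"
    \<comment> \<open>A variance is at most the second moment, and that of \<open>b\<close> is
      controlled by the gap at \<open>z\<close>.\<close>
    using average_norm_sq_centered[OF n_pos, of b] average_norm_grad_diff_sq_le[of z]
    by (simp add: b_def norm_minus_commute order_trans[OF _ average_norm_grad_diff_sq_le[of z]])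
  finally show ?thesis
    by (simp add: average_const[OF n_pos] algebra_simps)
qed

text \<open>Expand the square and use unbiasedness at the read point \<open>r\<close>. The
  comparison point \<open>u\<close> stays free because it will be both \<open>xstar\<close> and an
  earlier iterate.\<close>

lemma average_dist_sq_step_le:
  assumes "\<gamma> \<ge> 0"
  shows "average n (\<lambda>i. (norm (y - \<gamma> *\<^sub>R svrg_gradient n g z i r - u))\<^sup>2) \<le>
    (norm (y - u))\<^sup>2 - 2 * \<gamma> * (F y - F u) + \<gamma> * L * (norm (y - r))\<^sup>2
    + \<gamma>\<^sup>2 * average n (\<lambda>i. (norm (svrg_gradient n g z i r))\<^sup>2)"
proof -
  let ?v = "\<lambda>i. svrg_gradient n g z i r"
  have "average n (\<lambda>i. (norm (y - \<gamma> *\<^sub>R ?v i - u))\<^sup>2) =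
      average n (\<lambda>i. (norm (y - u))\<^sup>2 + \<gamma>\<^sup>2 * (norm (?v i))\<^sup>2 - (2 * \<gamma>) * inner (?v i) (y - u))"
    by (rule average_cong, unfold power2_norm_eq_inner)
      (simp add: inner_diff_left inner_diff_right inner_commute algebra_simps power2_eq_square)
  also have "\<dots> = (norm (y - u))\<^sup>2 + \<gamma>\<^sup>2 * average n (\<lambda>i. (norm (?v i))\<^sup>2) - (2 * \<gamma>) * inner (G r) (y - u)"
    by (simp add: average_add average_diff average_mult average_inner_left average_svrg_gradient
        average_const[OF n_pos])
  finally have eq: "average n (\<lambda>i. (norm (y - \<gamma> *\<^sub>R ?v i - u))\<^sup>2) =
    (norm (y - u))\<^sup>2 + \<gamma>\<^sup>2 * average n (\<lambda>i. (norm (?v i))\<^sup>2) - (2 * \<gamma>) * inner (G r) (y - u)" .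
  \<comment> \<open>The sum of the descent inequality from \<open>r\<close> to \<open>y\<close> and
    the tangent inequality from \<open>r\<close> to \<open>u\<close>.\<close>
  have "F y - F u - L / 2 * (norm (y - r))\<^sup>2 \<le> inner (G r) (y - u)"
    using F_descent[of y r] F_tangent_le[of r u] by (simp add: inner_diff_right)
  from mult_left_mono[OF this, of "2 * \<gamma>"] show ?thesis
    using assms unfolding eq by (simp add: algebra_simps)
qed

text \<open>A gradient at a stale point need not give descent. The lemma limits how far
  \<open>F\<close> can rise in one step, in terms of the read error and the size of the
  estimate.\<close>

lemma average_F_step_le:
  assumes "\<gamma> \<ge> 0"
  shows "average n (\<lambda>i. F (y - \<gamma> *\<^sub>R svrg_gradient n g z i r)) \<le>
    F y + \<gamma> * L\<^sup>2 / 4 * (norm (y - r))\<^sup>2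
    + L * \<gamma>\<^sup>2 / 2 * average n (\<lambda>i. (norm (svrg_gradient n g z i r))\<^sup>2)"
proof -
  let ?v = "\<lambda>i. svrg_gradient n g z i r"
  have "average n (\<lambda>i. F (y - \<gamma> *\<^sub>R ?v i)) \<le>
      average n (\<lambda>i. F y + L * \<gamma>\<^sup>2 / 2 * (norm (?v i))\<^sup>2 - \<gamma> * inner (?v i) (G y))"
  proof (rule average_mono)
    fix i
    show "F (y - \<gamma> *\<^sub>R ?v i) \<le> F y + L * \<gamma>\<^sup>2 / 2 * (norm (?v i))\<^sup>2 - \<gamma> * inner (?v i) (G y)"
      using F_descent[of "y - \<gamma> *\<^sub>R ?v i" y]
      by (simp add: power_mult_distrib inner_commute algebra_simps)
  qed
  also have "\<dots> = F y + L * \<gamma>\<^sup>2 / 2 * average n (\<lambda>i. (norm (?v i))\<^sup>2) - \<gamma> * inner (G r) (G y)"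
    by (simp only: average_add average_diff average_mult average_inner_left average_svrg_gradient
        average_const[OF n_pos])
  finally have le: "average n (\<lambda>i. F (y - \<gamma> *\<^sub>R ?v i)) \<le>
      F y + L * \<gamma>\<^sup>2 / 2 * average n (\<lambda>i. (norm (?v i))\<^sup>2) - \<gamma> * inner (G r) (G y)" .
  \<comment> \<open>By polarization the inner product is at least minus a quarter of the squared
    difference of the gradients.\<close>
  have lower: "- (L\<^sup>2 / 4 * (norm (y - r))\<^sup>2) \<le> inner (G r) (G y)"
  proof -
    have "(norm (G y - G r))\<^sup>2 \<le> L\<^sup>2 * (norm (y - r))\<^sup>2"
      using power_mono[OF norm_G_diff_le[of y r], of 2] by (simp add: power_mult_distrib)
    moreover have "(norm (G y + G r))\<^sup>2 - (norm (G y - G r))\<^sup>2 = 4 * inner (G r) (G y)"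
      unfolding power2_norm_eq_inner
      by (simp add: inner_diff_left inner_diff_right inner_add_left inner_add_right inner_commute)
    ultimately show ?thesis
      using zero_le_power2[of "norm (G y + G r)"] by linarith
  qed
  show ?thesis
    using le mult_left_mono[OF lower assms] by (simp add: algebra_simps)
qed

end

subsection \<open>The recursion over one epoch\<close>

text \<open>Exchange the sums: update \<open>l\<close> lies in the delay windows of at most \<tau>
  iterations, those from \<open>Suc l\<close> to \<open>l + \<tau>\<close>.\<close>

lemma sum_delayed_le:
  fixes V :: "nat \<Rightarrow> real"
  assumes V: "\<And>l. l < m \<Longrightarrow> 0 \<le> V l"
  shows "(\<Sum>k<m. \<Sum>l = k - \<tau>..<k. V l) \<le> real \<tau> * (\<Sum>l<m. V l)"
proof -
  have "(\<Sum>k<m. \<Sum>l = k - \<tau>..<k. V l) = (\<Sum>k<m. \<Sum>l | l \<in> {..<m} \<and> k - \<tau> \<le> l \<and> l < k. V l)"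
    by (intro sum.cong refl) auto
  also have "\<dots> = (\<Sum>l<m. \<Sum>k | k \<in> {..<m} \<and> k - \<tau> \<le> l \<and> l < k. V l)"
    by (rule sum.swap_restrict) auto
  also have "\<dots> \<le> (\<Sum>l<m. real \<tau> * V l)"
  proof (rule sum_mono)
    fix l assume l: "l \<in> {..<m}"
    have "card {k \<in> {..<m}. k - \<tau> \<le> l \<and> l < k} \<le> card {Suc l..l + \<tau>}"
      by (intro card_mono) auto
    with V l show "(\<Sum>k | k \<in> {..<m} \<and> k - \<tau> \<le> l \<and> l < k. V l) \<le> real \<tau> * V l"
      by (auto intro!: mult_right_mono)
  qed
  finally show ?thesis
    by (simp add: sum_distrib_left)
qed

text \<open>Read errors \<open>B\<close> are bounded by past updates \<open>V\<close>, and updates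
  in turn by read errors and gaps. Summed over the epoch, this loop closes because the read errors
  return only a small fraction of the updates.\<close>

lemma epoch_noise_le:
  fixes V B p :: "nat \<Rightarrow> real"
  assumes pos: "\<gamma> > 0" "L > 0" "\<tau> \<ge> 1" and step: "\<gamma> * L * (real \<tau>)\<^sup>2 \<le> 1 / 100"
    and V_nonneg: "\<And>k. k < m \<Longrightarrow> 0 \<le> V k"
    and V_le: "\<And>k. k < m \<Longrightarrow> V k \<le> 3 * L\<^sup>2 * B k + 6 * L * (p k + P)"
    and B_le: "\<And>k. k < m \<Longrightarrow> B k \<le> \<gamma>\<^sup>2 * real \<tau> * (\<Sum>l = k - \<tau>..<k. V l)"
  shows "(\<Sum>k<m. \<gamma> * L * B k + \<gamma>\<^sup>2 * V k) \<le> \<gamma> / 15 * ((\<Sum>k<m. p k) + real m * P)"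
    and "\<gamma> * L \<le> 1 / 100"
proof -
  define v where "v = (\<Sum>k<m. V k)"
  define b where "b = (\<Sum>k<m. B k)"
  define t where "t = (\<Sum>k<m. p k) + real m * P"
  have "\<gamma> * L * 1 \<le> \<gamma> * L * (real \<tau>)\<^sup>2"
    using pos by (intro mult_left_mono) auto
  then show gL: "\<gamma> * L \<le> 1 / 100"
    using step by simp
  have v_nonneg: "0 \<le> v"
    unfolding v_def by (intro sum_nonneg V_nonneg) auto
  have "b \<le> (\<Sum>k<m. \<gamma>\<^sup>2 * real \<tau> * (\<Sum>l = k - \<tau>..<k. V l))"
    unfolding b_def by (intro sum_mono B_le) auto
  also have "\<dots> \<le> \<gamma>\<^sup>2 * real \<tau> * (real \<tau> * v)"
    unfolding sum_distrib_left[symmetric] v_def using pos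
    by (intro mult_left_mono sum_delayed_le V_nonneg) auto
  finally have b: "\<gamma> * L * b \<le> \<gamma> * L * (\<gamma>\<^sup>2 * real \<tau> * (real \<tau> * v))"
    using pos by (intro mult_left_mono) auto
  also have "\<dots> = (\<gamma> * L * (real \<tau>)\<^sup>2) * (\<gamma>\<^sup>2 * v)"
    by (simp add: power2_eq_square)
  also have "\<dots> \<le> 1 / 100 * (\<gamma>\<^sup>2 * v)"
    using v_nonneg by (intro mult_right_mono step) auto
  finally have Lb: "\<gamma> * L * b \<le> 1 / 100 * (\<gamma>\<^sup>2 * v)" .
  then have "\<gamma> * (L * b) \<le> \<gamma> * (1 / 100 * (\<gamma> * v))"
    by (simp only: power2_eq_square mult.assoc mult.left_commute[of "1 / 100"])
  then have "L * b \<le> 1 / 100 * (\<gamma> * v)"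
    using pos by simp
  then have "L * (L * b) \<le> L * (1 / 100 * (\<gamma> * v))"
    using pos by (intro mult_left_mono) auto
  also have "\<dots> = 1 / 100 * (\<gamma> * L) * v"
    by simp
  also have "\<dots> \<le> 1 / 100 * (1 / 100) * v"
    using gL v_nonneg by (intro mult_right_mono mult_left_mono) auto
  finally have LLb: "L\<^sup>2 * b \<le> 1 / 10000 * v"
    by (simp add: power2_eq_square)
  have "v \<le> (\<Sum>k<m. 3 * L\<^sup>2 * B k + 6 * L * (p k + P))"
    unfolding v_def by (intro sum_mono V_le) auto
  also have "\<dots> = 3 * (L\<^sup>2 * b) + 6 * (L * t)"
    by (simp add: b_def t_def sum.distrib sum_distrib_left sum_distrib_right algebra_simps)
  \<comment> \<open>The returned fraction is 3/10000, and 6 / (1 - 3/10000) is below 61/10.\<close>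
  finally have v: "v \<le> 61 / 10 * (L * t)"
    using LLb v_nonneg by linarith
  \<comment> \<open>The sign of \<open>t\<close> is read off from the bound it gives on the
    nonnegative \<open>v\<close>.\<close>
  then have Lt: "0 \<le> L * t"
    using v_nonneg by linarith
  then have t: "0 \<le> t"
    using pos by (simp add: zero_le_mult_iff)
  have "(\<Sum>k<m. \<gamma> * L * B k + \<gamma>\<^sup>2 * V k) = \<gamma> * L * b + \<gamma>\<^sup>2 * v"
    by (simp add: b_def v_def sum.distrib sum_distrib_left)
  also have "\<dots> \<le> 101 / 100 * (\<gamma>\<^sup>2 * v)"
    using Lb by linarith
  also have "\<dots> \<le> 101 / 100 * (\<gamma>\<^sup>2 * (61 / 10 * (L * t)))"
    using v by (intro mult_left_mono) auto
  also have "\<dots> = 101 / 100 * (61 / 10) * (\<gamma> * L) * (\<gamma> * t)"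
    by (simp add: power2_eq_square)
  also have "\<dots> \<le> 101 / 100 * (61 / 10) * (1 / 100) * (\<gamma> * t)"
    using gL t pos by (intro mult_right_mono mult_left_mono) auto
  \<comment> \<open>The product of the three constants is 0.06161.\<close>
  also have "\<dots> \<le> 1 / 15 * (\<gamma> * t)"
    using t pos by (intro mult_right_mono) auto
  finally show "(\<Sum>k<m. \<gamma> * L * B k + \<gamma>\<^sup>2 * V k) \<le> \<gamma> / 15 * ((\<Sum>k<m. p k) + real m * P)"
    by (simp add: t_def)
qed

text \<open>Double counting: \<open>p k\<close> occurs in the segments with K from k+1 to m. These
  weights arise when the telescoped distances are averaged over the epoch.\<close>

lemma sum_initial_segments:
  "(\<Sum>K = 1..m. \<Sum>k<K. p k) = (\<Sum>k<m. real (m - k) * p k)" for p :: "nat \<Rightarrow> real"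
proof (induction m)
  case (Suc m)
  have "(\<Sum>k<m. real (Suc m - k) * p k) = (\<Sum>k<m. real (m - k) * p k + p k)"
    by (intro sum.cong) (auto simp: Suc_diff_le algebra_simps)
  with Suc show ?case
    by (simp add: sum.distrib)
qed simp

text \<open>Here \<open>p k\<close> occurs for j from 0 to k. Its weight k+1 complements the weight
  m-k of the initial segments to the constant m+1.\<close>

lemma sum_final_segments:
  "(\<Sum>j<m. \<Sum>k = j..<m. p k) = (\<Sum>k<m. real (Suc k) * p k)" for p :: "nat \<Rightarrow> real"
proof (induction m)
  case (Suc m)
  have "(\<Sum>j<m. \<Sum>k = j..<Suc m. p k) = (\<Sum>j<m. (\<Sum>k = j..<m. p k) + p m)"
    by (intro sum.cong) auto
  with Suc show ?case
    by (simp add: sum.distrib algebra_simps)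
qed simp

text \<open>The comparison of \<open>p k\<close> with the earlier values \<open>p j\<close> shows that the mass of \<open>p\<close> cannot sit at the
  end of the epoch. This is what makes the average of the squared distances decrease, although it
  gives late steps little weight.\<close>

lemma epoch_recursion:
  fixes A B V p :: "nat \<Rightarrow> real" and W :: "nat \<Rightarrow> nat \<Rightarrow> real"
  assumes pos: "\<gamma> > 0" "L > 0" "\<tau> \<ge> 1" "m \<ge> 1" and step: "\<gamma> * L * (real \<tau>)\<^sup>2 \<le> 1 / 100"
    and nonneg: "\<And>k. k < m \<Longrightarrow> 0 \<le> V k" "\<And>k. k < m \<Longrightarrow> 0 \<le> B k" "\<And>k. k < m \<Longrightarrow> 0 \<le> p k"
      "\<And>k. k \<le> m \<Longrightarrow> 0 \<le> A k" "\<And>j k. j \<le> k \<Longrightarrow> k \<le> m \<Longrightarrow> 0 \<le> W j k" "0 \<le> P"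
    and V_le: "\<And>k. k < m \<Longrightarrow> V k \<le> 3 * L\<^sup>2 * B k + 6 * L * (p k + P)"
    and B_le: "\<And>k. k < m \<Longrightarrow> B k \<le> \<gamma>\<^sup>2 * real \<tau> * (\<Sum>l = k - \<tau>..<k. V l)"
    and A_Suc: "\<And>k. k < m \<Longrightarrow> A (Suc k) \<le> A k - 2 * \<gamma> * p k + \<gamma> * L * B k + \<gamma>\<^sup>2 * V k"
    and W_start: "\<And>j. j < m \<Longrightarrow> W j j = 0"
    and W_Suc: "\<And>j k. j \<le> k \<Longrightarrow> k < m \<Longrightarrow>
      W j (Suc k) \<le> W j k - 2 * \<gamma> * (p k - p j) + \<gamma> * L * B k + \<gamma>\<^sup>2 * V k"
    and p_Suc: "\<And>k. k < m \<Longrightarrow> p (Suc k) \<le> p k + \<gamma> * L\<^sup>2 / 4 * B k + L * \<gamma>\<^sup>2 / 2 * V k"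
    and P': "P' \<le> average m p" and D': "D' \<le> average m A"
  shows "D' / (2 * \<gamma> * real m) + P' / 10 \<le> A 0 / (2 * \<gamma> * real m) + P / 10"
    and "P' \<le> 21 / 20 * (A 0 / (2 * \<gamma> * real m) + P / 10)"
proof -
  define N where "N k = \<gamma> * L * B k + \<gamma>\<^sup>2 * V k" for k
  define R where "R = (\<Sum>k<m. N k)"
  define T where "T = (\<Sum>k<m. p k)"
  have N_nonneg: "0 \<le> N k" if "k < m" for k
    using that pos nonneg by (simp add: N_def)
  have N_le_R: "(\<Sum>k\<in>I. N k) \<le> R" if "I \<subseteq> {..<m}" for I
    unfolding R_def using that N_nonneg by (intro sum_mono2) auto
  have R: "R \<le> \<gamma> / 15 * (T + real m * P)" and gL: "\<gamma> * L \<le> 1 / 100"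
    using epoch_noise_le[where V = V and B = B and p = p and P = P, OF pos(1-3) step nonneg(1) V_le B_le]
    by (auto simp: R_def N_def T_def)
  have T_nonneg: "0 \<le> T"
    unfolding T_def by (intro sum_nonneg nonneg) auto

  have A_sum: "A K \<le> A 0 - 2 * \<gamma> * (\<Sum>k<K. p k) + (\<Sum>k<K. N k)" if "K \<le> m" for K
    using that
  proof (induction K)
    case (Suc K)
    with A_Suc[of K] show ?case by (simp add: N_def algebra_simps)
  qed simp
  then have A_le: "A K \<le> A 0 - 2 * \<gamma> * (\<Sum>k<K. p k) + R" if "K \<le> m" for K
    using that N_le_R[of "{..<K}"] by force
  have W_sum: "W j K \<le> - (2 * \<gamma> * (\<Sum>k = j..<K. p k - p j)) + (\<Sum>k = j..<K. N k)"
    if "j \<le> K" "K \<le> m" "j < m" for j K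
    using that
  proof (induction K rule: dec_induct)
    case base
    with W_start show ?case by simp
  next
    case (step K)
    with W_Suc[of j K] show ?case by (simp add: N_def algebra_simps)
  qed
  \<comment> \<open>With the iterate at \<open>j\<close> as comparison point the squared distance
    starts at zero and ends nonnegative, so after \<open>j\<close> the values \<open>p k\<close>
    exceed \<open>p j\<close> in total by at most R/(2\<gamma>).\<close>
  have window: "2 * \<gamma> * ((\<Sum>k = j..<m. p k) - real (m - j) * p j) \<le> R" if "j < m" for j
  proof -
    have "{j..<m} \<subseteq> {..<m}" by auto
    with W_sum[of j m] nonneg(5)[of j m] N_le_R[of "{j..<m}"] that show ?thesis
      by (simp add: sum_subtractf)
  qed

  \<comment> \<open>\<open>X\<close> carries the weights from averaging the distances,
    \<open>Y\<close> those from summing the windows. A bound on \<open>Y - X\<close> and the fixed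
    sum \<open>X + Y\<close> give a lower bound on \<open>X\<close>.\<close>
  define X where "X = (\<Sum>k<m. real (m - k) * p k)"
  define Y where "Y = (\<Sum>k<m. real (Suc k) * p k)"
  have "X + Y = (\<Sum>k<m. (real m + 1) * p k)"
    unfolding X_def Y_def sum.distrib[symmetric]
    by (intro sum.cong) (auto simp: of_nat_diff algebra_simps)
  then have XY: "X + Y = (real m + 1) * T"
    by (simp add: T_def sum_distrib_left)
  have "(\<Sum>j<m. 2 * \<gamma> * ((\<Sum>k = j..<m. p k) - real (m - j) * p j)) \<le> (\<Sum>j<m. R)"
    by (intro sum_mono window) auto
  then have "2 * \<gamma> * (Y - X) \<le> real m * R"
    unfolding sum_distrib_left[symmetric] sum_subtractf sum_final_segments
    by (simp add: X_def Y_def)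
  moreover have "2 * \<gamma> * X * 2 = 2 * \<gamma> * ((real m + 1) * T) - 2 * \<gamma> * (Y - X)"
    unfolding XY[symmetric] by (simp add: algebra_simps)
  moreover have "2 * \<gamma> * ((real m + 1) * T) \<ge> 2 * \<gamma> * (real m * T)"
    using pos T_nonneg by (intro mult_left_mono mult_right_mono) auto
  \<comment> \<open>Apart from noise, \<open>X\<close> is at least half of m T, the value it would
    have for constant \<open>p\<close>.\<close>
  ultimately have X: "2 * \<gamma> * X \<ge> \<gamma> * real m * T - real m * R / 2"
    by simp

  have "(\<Sum>K = 1..m. A K) \<le> (\<Sum>K = 1..m. A 0 + R - 2 * \<gamma> * (\<Sum>k<K. p k))"
    by (intro sum_mono) (use A_le in \<open>force simp: algebra_simps\<close>)
  also have "\<dots> = real m * (A 0 + R) - 2 * \<gamma> * X"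
    unfolding sum_subtractf sum_distrib_left[symmetric] sum_initial_segments X_def by simp
  finally have "real m * average m A \<le> real m * (A 0 + R) - 2 * \<gamma> * X"
    by (simp only: mult_average[OF pos(4)])
  also have "\<dots> \<le> real m * (A 0 + 3 / 2 * R - \<gamma> * T)"
    using X by (simp add: algebra_simps)
  finally have "average m A \<le> A 0 + 3 / 2 * R - \<gamma> * T"
    using pos by simp
  \<comment> \<open>The factor 3/2 turns the noise share 1/15 into 1/10.\<close>
  with D' R have D'_le: "D' \<le> A 0 + \<gamma> / 10 * (T + real m * P) - \<gamma> * T"
    by simp

  \<comment> \<open>The snapshot averages the iterates 1 to m, whereas \<open>T\<close> sums the
    gaps at 0 to m-1. The one-step bound on the rise of \<open>F\<close> makes up for the
    shift.\<close>
  have "(\<Sum>k<m. p (Suc k)) \<le> (\<Sum>k<m. p k + L * N k)"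
  proof (rule sum_mono)
    fix k assume k: "k \<in> {..<m}"
    have "0 \<le> \<gamma> * L\<^sup>2 * B k" "0 \<le> L * \<gamma>\<^sup>2 * V k"
      using k pos nonneg by auto
    with p_Suc[of k] k show "p (Suc k) \<le> p k + L * N k"
      by (simp add: N_def algebra_simps power2_eq_square)
  qed
  also have "\<dots> = T + L * R"
    by (simp add: sum.distrib T_def R_def sum_distrib_left)
  also have "L * R \<le> L * (\<gamma> / 15 * (T + real m * P))"
    using R pos by (intro mult_left_mono) auto
  also have "\<dots> = \<gamma> * L * ((T + real m * P) / 15)"
    by simp
  also have "\<dots> \<le> 1 / 100 * ((T + real m * P) / 15)"
    using gL T_nonneg nonneg by (intro mult_right_mono) auto
  also have "(\<Sum>k<m. p (Suc k)) = (\<Sum>k = 1..m. p k)"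
    using sum.shift_bounds_Suc_ivl[of p 0 m] by (simp add: atLeastLessThanSuc_atLeastAtMost lessThan_atLeast0)
  finally have "real m * average m p \<le> 101 / 100 * T + 1 / 100 * (real m * P)"
    using T_nonneg mult_nonneg_nonneg[OF of_nat_0_le_iff nonneg(6), of m]
    unfolding mult_average[OF pos(4)] by (simp add: field_simps)
  with P' have "real m * P' \<le> 101 / 100 * T + 1 / 100 * (real m * P)"
    by (meson mult_left_mono of_nat_0_le_iff order_trans)
  then have P'_le: "P' \<le> 101 / 100 * (T / real m) + 1 / 100 * P"
    using pos by (simp add: field_simps)

  \<comment> \<open>Scaling by 2\<gamma>m and by m leaves linear inequalities in \<open>Q\<close>,
    \<open>T'\<close>, \<open>P\<close> and \<open>P'\<close> with numerical coefficients.\<close>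
  define Q where "Q = A 0 / (2 * \<gamma> * real m)"
  define T' where "T' = T / real m"
  have T': "T = real m * T'" and Q: "A 0 = 2 * \<gamma> * real m * Q"
    using pos by (simp_all add: T'_def Q_def)
  have "0 \<le> T'"
    using T_nonneg by (simp add: T'_def)
  have "D' \<le> 2 * \<gamma> * real m * (Q + (T' + P) / 20 - T' / 2)"
    using D'_le unfolding T' Q by (simp add: field_simps)
  then have Q': "D' / (2 * \<gamma> * real m) \<le> Q + (T' + P) / 20 - T' / 2"
    using pos by (simp add: pos_divide_le_eq mult.commute)
  \<comment> \<open>The final squared distance is nonnegative, so the initial distance and the noise
    pay for all gaps of the epoch.\<close>
  have "2 * \<gamma> * T \<le> A 0 + R"
    using A_le[of m] nonneg(4)[of m] by (simp add: T_def)
  with R have "2 * \<gamma> * T \<le> A 0 + \<gamma> / 15 * (T + real m * P)"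
    by linarith
  then have "(2 * \<gamma> * real m) * T' \<le> (2 * \<gamma> * real m) * (Q + (T' + P) / 30)"
    unfolding T' Q by (simp add: field_simps)
  then have T'_le: "T' \<le> Q + (T' + P) / 30"
    using pos by simp
  show "D' / (2 * \<gamma> * real m) + P' / 10 \<le> A 0 / (2 * \<gamma> * real m) + P / 10"
  proof -
    \<comment> \<open>The coefficient of \<open>T'\<close> is 1/20 - 1/2 + 101/1000, which is
      negative, and that of \<open>P\<close> is 1/20 + 1/1000, below 1/10. \<open>R'\<close> stands
      for the scaled distance to keep the arithmetic linear.\<close>
    have "R' + P' / 10 \<le> Q + P / 10" if "R' \<le> Q + (T' + P) / 20 - T' / 2" for R'
      using that P'_le \<open>0 \<le> T'\<close> nonneg(6) unfolding T'_def[symmetric] by (simp add: field_simps)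
    with Q' show ?thesis
      by (simp add: Q_def)
  qed
  show "P' \<le> 21 / 20 * (A 0 / (2 * \<gamma> * real m) + P / 10)"
    \<comment> \<open>Solving for \<open>T'\<close> gives at most 30/29 Q + P/29. Multiplied by
      101/100, the coefficient of \<open>Q\<close> stays below 21/20.\<close>
    using T'_le P'_le \<open>0 \<le> T'\<close> nonneg(6) unfolding T'_def[symmetric] Q_def[symmetric]
    by (simp add: field_simps)
qed

subsection \<open>Simple random variables\<close>

lemma simple_function_measurable_count_space:
  assumes "I \<in> N \<rightarrow>\<^sub>M count_space A" "finite A"
  shows "simple_function N I"
  unfolding simple_function_def
proof (intro conjI ballI)
  have sub: "I ` space N \<subseteq> A"
    using measurable_space[OF assms(1)] by auto
  then show "finite (I ` space N)"
    using assms(2) by (rule finite_subset)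
  fix c assume "c \<in> I ` space N"
  with sub show "I -` {c} \<inter> space N \<in> sets N"
    by (intro measurable_sets[OF assms(1)]) auto
qed

text \<open>The finitely many membership events determine the set, so each fibre is a finite
  intersection of them or their complements.\<close>

lemma simple_function_finite_set:
  fixes U :: "'w \<Rightarrow> 'd::finite set"
  assumes "\<And>p. {\<omega> \<in> space N. p \<in> U \<omega>} \<in> sets N"
  shows "simple_function N U"
  unfolding simple_function_def
proof (intro conjI ballI)
  fix c
  have "{\<omega> \<in> space N. p \<in> U \<omega> \<longleftrightarrow> p \<in> c} \<in> sets N" for p
    using assms sets.sets_Collect_neg[OF assms] by (cases "p \<in> c") auto
  then have "{\<omega> \<in> space N. \<forall>p\<in>UNIV. p \<in> U \<omega> \<longleftrightarrow> p \<in> c} \<in> sets N"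
    by (intro sets.sets_Collect_finite_All) auto
  also have "{\<omega> \<in> space N. \<forall>p\<in>UNIV. p \<in> U \<omega> \<longleftrightarrow> p \<in> c} = U -` {c} \<inter> space N"
    by auto
  finally show "U -` {c} \<inter> space N \<in> sets N" .
qed simp

lemma simple_function_average:
  "(\<And>i. i \<in> {1..n} \<Longrightarrow> simple_function N (a i)) \<Longrightarrow> simple_function N (\<lambda>\<omega>. average n (\<lambda>i. a i \<omega>))"
  unfolding average_def by (intro simple_function_compose1[where g = "\<lambda>y. y /\<^sub>R _"] simple_function_sum)

section \<open>Expectations of finitely valued variables and of a uniform random index\<close>

context prob_space
begin

lemma integrable_simple: "simple_function M h \<Longrightarrow> integrable M h" for h :: "'a \<Rightarrow> real"
  by (rule integrable_simple_function) auto

lemma expectation_mono_simple: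
  fixes X Y :: "'a \<Rightarrow> real"
  assumes "simple_function M X" "simple_function M Y" "\<And>\<omega>. \<omega> \<in> space M \<Longrightarrow> X \<omega> \<le> Y \<omega>"
  shows "expectation X \<le> expectation Y"
  using assms by (intro integral_mono integrable_simple)

lemma expectation_average:
  fixes X :: "nat \<Rightarrow> 'a \<Rightarrow> real"
  assumes "\<And>i. i \<in> {1..n} \<Longrightarrow> simple_function M (X i)"
  shows "expectation (\<lambda>\<omega>. average n (\<lambda>i. X i \<omega>)) = average n (\<lambda>i. expectation (X i))"
  unfolding average_def using assms
  by (subst integral_scaleR_right, subst Bochner_Integration.integral_sum) (auto intro: integrable_simple)

text \<open>\<open>X\<close> is a finite combination of indicators of events in \<open>N\<close>,
  and \<open>A\<close> is independent of each of these.\<close>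

lemma expectation_indicator_times_indep:
  fixes X :: "'a \<Rightarrow> real"
  assumes sub: "subalgebra M N" and X: "simple_function N X"
    and A: "A \<in> sets M" and indep: "\<And>B. B \<in> sets N \<Longrightarrow> prob (B \<inter> A) = prob B * prob A"
  shows "expectation (\<lambda>\<omega>. indicator A \<omega> * X \<omega>) = prob A * expectation X"
proof -
  define C where "C y = X -` {y} \<inter> space M" for y
  have space: "space N = space M"
    using sub by (simp add: subalgebra_def)
  have C: "C y \<in> sets N" for y
    using simple_functionD(2)[OF X, of "{y}"] by (simp add: C_def space)
  then have CM: "C y \<in> sets M" for y
    using sub by (auto simp: subalgebra_def)
  have X_eq: "X \<omega> = (\<Sum>y\<in>X ` space M. indicator (C y) \<omega> * y)" if "\<omega> \<in> space M" for \<omega>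
    using simple_function_indicator_representation_banach[OF X, unfolded space, OF that]
    unfolding C_def real_scaleR_def .
  have sum_eq: "expectation (\<lambda>\<omega>. \<Sum>y\<in>X ` space M. indicator (E y) \<omega> * y) = (\<Sum>y\<in>X ` space M. prob (E y) * y)"
    if "\<And>y. E y \<in> sets M" for E
  proof -
    have "expectation (\<lambda>\<omega>. indicator (E y) \<omega> * y) = prob (E y) * y" for y
      using sets.sets_into_space[OF that] by (simp add: Int_absorb2)
    then show ?thesis
      using that by (subst Bochner_Integration.integral_sum)
        (auto intro!: integrable_simple simple_function_mult simple_function_indicator)
  qed
  have "expectation (\<lambda>\<omega>. indicator A \<omega> * X \<omega>) =
      expectation (\<lambda>\<omega>. \<Sum>y\<in>X ` space M. indicator (C y \<inter> A) \<omega> * y)"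
  proof (rule Bochner_Integration.integral_cong[OF refl])
    fix \<omega> assume "\<omega> \<in> space M"
    then show "indicator A \<omega> * X \<omega> = (\<Sum>y\<in>X ` space M. indicator (C y \<inter> A) \<omega> * y)"
      by (simp only: X_eq sum_distrib_left indicator_inter_arith mult.assoc mult.left_commute)
  qed
  also have "\<dots> = (\<Sum>y\<in>X ` space M. prob (C y \<inter> A) * y)"
    by (intro sum_eq sets.Int CM A)
  also have "\<dots> = prob A * (\<Sum>y\<in>X ` space M. prob (C y) * y)"
    using indep[OF C] by (simp add: sum_distrib_left mult.assoc mult.left_commute)
  also have "(\<Sum>y\<in>X ` space M. prob (C y) * y) =
      expectation (\<lambda>\<omega>. \<Sum>y\<in>X ` space M. indicator (C y) \<omega> * y)"
    by (intro sum_eq[symmetric] CM)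
  also have "\<dots> = expectation X"
    by (intro Bochner_Integration.integral_cong X_eq[symmetric] refl)
  finally show ?thesis .
qed

text \<open>This takes the place of conditional expectation. The space is partitioned by the value
  of \<open>I\<close>; each piece has probability 1/n and is independent of the corresponding
  \<open>\<Psi> i\<close>.\<close>

lemma expectation_uniform_index:
  fixes \<Psi> :: "nat \<Rightarrow> 'a \<Rightarrow> real"
  assumes n: "n \<ge> 1" and sub: "subalgebra M N"
    and I: "I \<in> M \<rightarrow>\<^sub>M count_space {1..n}"
    and unif: "distr M (count_space {1..n}) I = uniform_count_measure {1..n}"
    and indep: "indep_set (sets N) (sets (vimage_algebra (space M) I (count_space {1..n})))"
    and \<Psi>: "\<And>i. i \<in> {1..n} \<Longrightarrow> simple_function N (\<Psi> i)"
  shows "expectation (\<lambda>\<omega>. \<Psi> (I \<omega>) \<omega>) = average n (\<lambda>i. expectation (\<Psi> i))"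
proof -
  define A where "A i = I -` {i} \<inter> space M" for i
  have A: "A i \<in> sets M" if "i \<in> {1..n}" for i
    using that I unfolding A_def by (intro measurable_sets[OF I]) auto
  have prob_A: "prob (A i) = 1 / real n" if "i \<in> {1..n}" for i
  proof -
    have "prob (A i) = measure (distr M (count_space {1..n}) I) {i}"
      using that I unfolding A_def by (subst measure_distr) auto
    then show ?thesis
      using that n unfolding unif by (simp add: measure_uniform_count_measure)
  qed
  have A_vimage: "A i \<in> sets (vimage_algebra (space M) I (count_space {1..n}))" if "i \<in> {1..n}" for i
    using that unfolding A_def by (intro in_vimage_algebra) auto
  have \<Psi>M: "simple_function M (\<Psi> i)" if "i \<in> {1..n}" for i
    using \<Psi>[OF that] sub by (auto simp: subalgebra_def intro: simple_function_subalgebra)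
  have "expectation (\<lambda>\<omega>. \<Psi> (I \<omega>) \<omega>) = expectation (\<lambda>\<omega>. \<Sum>i = 1..n. indicator (A i) \<omega> * \<Psi> i \<omega>)"
  proof (rule Bochner_Integration.integral_cong[OF refl])
    fix \<omega> assume \<omega>: "\<omega> \<in> space M"
    then have "I \<omega> \<in> {1..n}"
      using measurable_space[OF I] by simp
    moreover have "indicator (A i) \<omega> = (if i = I \<omega> then 1 else 0 :: real)" for i
      using \<omega> by (auto simp: A_def indicator_def)
    ultimately show "\<Psi> (I \<omega>) \<omega> = (\<Sum>i = 1..n. indicator (A i) \<omega> * \<Psi> i \<omega>)"
      by (simp add: if_distrib[of "\<lambda>c. c * _"] cong: if_cong)
  qed
  also have "\<dots> = (\<Sum>i = 1..n. expectation (\<lambda>\<omega>. indicator (A i) \<omega> * \<Psi> i \<omega>))"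
    using A \<Psi>M by (intro Bochner_Integration.integral_sum integrable_simple simple_function_mult
        simple_function_indicator) auto
  also have "\<dots> = (\<Sum>i = 1..n. prob (A i) * expectation (\<Psi> i))"
    by (intro sum.cong refl expectation_indicator_times_indep[OF sub] \<Psi> A
        indep_setD[OF indep] A_vimage)
  also have "\<dots> = average n (\<lambda>i. expectation (\<Psi> i))"
    using prob_A by (simp add: average_def sum_distrib_left divide_inverse)
  finally show ?thesis .
qed

end

lemma simple_function_dist_sq:
  fixes X Y :: "'w \<Rightarrow> 'a::real_normed_vector"
  shows "simple_function N X \<Longrightarrow> simple_function N Y \<Longrightarrow> simple_function N (\<lambda>\<omega>. (norm (X \<omega> - Y \<omega>))\<^sup>2)"
  by (rule simple_function_compose2)

subsection \<open>The lock-free algorithm\<close>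

lemma norm_unwritten_part_sq_le: "(norm (unwritten_part A w))\<^sup>2 \<le> (norm w)\<^sup>2"
  for w :: "real ^ 'c"
  by (intro power_mono norm_le_componentwise_cart) (auto simp: unwritten_part_def)

text \<open>The step size enters in the form that the noise estimate consumes;
  \<open>step_size_bound\<close> derives it from the constants of the theorem.\<close>

locale asvrg = prob_space M + finite_sum n f g F L xstar
  for M :: "'w measure" and n :: nat and f :: "nat \<Rightarrow> real ^ 'd \<Rightarrow> real"
    and g :: "nat \<Rightarrow> real ^ 'd \<Rightarrow> real ^ 'd" and F :: "real ^ 'd \<Rightarrow> real" and L :: real
    and xstar :: "real ^ 'd" +
  fixes H :: "nat \<Rightarrow> nat \<Rightarrow> 'w measure" and \<tau> m S :: nat and \<gamma> :: real and x00 :: "real ^ 'd"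
    and ind :: "nat \<Rightarrow> nat \<Rightarrow> 'w \<Rightarrow> nat"
    and U :: "nat \<Rightarrow> nat \<Rightarrow> nat \<Rightarrow> 'w \<Rightarrow> 'd set"
    and x xr v :: "nat \<Rightarrow> nat \<Rightarrow> 'w \<Rightarrow> real ^ 'd"
    and xt :: "nat \<Rightarrow> 'w \<Rightarrow> real ^ 'd"
  assumes m_pos: "m \<ge> 1" and tau_pos: "\<tau> \<ge> 1" and gamma_pos: "\<gamma> > 0"
    and step_size: "\<gamma> * L * (real \<tau>)\<^sup>2 \<le> 1 / 100"
    and sampling: "asvrg_sampling M H n \<tau> m S ind U"
    and run: "\<omega> \<in> space M \<Longrightarrow>
      asvrg_run n g \<gamma> \<tau> m S x00 (\<lambda>s k. ind s k \<omega>) (\<lambda>s k l. U s k l \<omega>)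
        (\<lambda>s k. x s k \<omega>) (\<lambda>s k. xr s k \<omega>) (\<lambda>s k. v s k \<omega>) (\<lambda>s. xt s \<omega>)"
begin

section \<open>Equations of a run and the information available before each draw\<close>

lemma x_0_0: "\<omega> \<in> space M \<Longrightarrow> x 0 0 \<omega> = x00"
  and xt_0: "\<omega> \<in> space M \<Longrightarrow> xt 0 \<omega> = x00"
  and xr_eq: "\<omega> \<in> space M \<Longrightarrow> s < S \<Longrightarrow> k < m \<Longrightarrow>
    xr s k \<omega> = x s k \<omega> + \<gamma> *\<^sub>R (\<Sum>l = k - \<tau>..<k. unwritten_part (U s k l \<omega>) (v s l \<omega>))"
  and v_eq: "\<omega> \<in> space M \<Longrightarrow> s < S \<Longrightarrow> k < m \<Longrightarrow>
    v s k \<omega> = svrg_gradient n g (xt s \<omega>) (ind s k \<omega>) (xr s k \<omega>)"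
  and x_Suc: "\<omega> \<in> space M \<Longrightarrow> s < S \<Longrightarrow> k < m \<Longrightarrow> x s (Suc k) \<omega> = x s k \<omega> - \<gamma> *\<^sub>R v s k \<omega>"
  and x_Suc_0: "\<omega> \<in> space M \<Longrightarrow> s < S \<Longrightarrow> x (Suc s) 0 \<omega> = average m (\<lambda>k. x s k \<omega>)"
  and xt_Suc: "\<omega> \<in> space M \<Longrightarrow> s < S \<Longrightarrow> xt (Suc s) \<omega> = average m (\<lambda>k. x s k \<omega>)"
  using run[of \<omega>] unfolding asvrg_run_def by auto

lemma x_start: "\<omega> \<in> space M \<Longrightarrow> s \<le> S \<Longrightarrow> x s 0 \<omega> = xt s \<omega>"
  by (cases s) (auto simp: x_0_0 xt_0 x_Suc_0 xt_Suc)

text \<open>The predicates take the \<sigma>-algebra as a parameter, so that one induction serves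
  both \<open>H s k\<close> and \<open>M\<close>.\<close>

definition read_known :: "'w measure \<Rightarrow> nat \<Rightarrow> nat \<Rightarrow> bool" where
  "read_known N s k \<longleftrightarrow> (\<forall>l\<in>{k - \<tau>..<k}. simple_function N (U s k l))"

definition past_known :: "'w measure \<Rightarrow> nat \<Rightarrow> nat \<Rightarrow> bool" where
  "past_known N s k \<longleftrightarrow> (\<forall>s'<S. \<forall>k'<m. s' < s \<or> s' = s \<and> k' < k \<longrightarrow>
     simple_function N (ind s' k') \<and> read_known N s' k')"

lemma past_known_mono:
  "past_known N s k \<Longrightarrow> s' < s \<or> s' = s \<and> k' \<le> k \<Longrightarrow> past_known N s' k'"
  by (auto simp: past_known_def)

lemma
  assumes s: "s < S" and k: "k < m"
  shows subalgebra_H: "subalgebra M (H s k)"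
    and past_known_H: "past_known (H s k) s k"
    and read_known_H: "read_known (H s k) s k"
    and ind_measurable: "ind s k \<in> M \<rightarrow>\<^sub>M count_space {1..n}"
    and ind_uniform: "distr M (count_space {1..n}) (ind s k) = uniform_count_measure {1..n}"
    and ind_indep: "indep_set (sets (H s k))
          (sets (vimage_algebra (space M) (ind s k) (count_space {1..n})))"
proof -
  note * = sampling[unfolded asvrg_sampling_def, rule_format, OF s k]
  show sub: "subalgebra M (H s k)"
    and "ind s k \<in> M \<rightarrow>\<^sub>M count_space {1..n}"
    and "distr M (count_space {1..n}) (ind s k) = uniform_count_measure {1..n}"
    and "indep_set (sets (H s k))
          (sets (vimage_algebra (space M) (ind s k) (count_space {1..n})))"
    using * by blast+
  have space: "space (H s k) = space M"
    using sub by (simp add: subalgebra_def)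
  \<comment> \<open>Read patterns are known up to and including iteration \<open>k\<close>, indices
    only before it. This asymmetry makes the read point, but not the direction, known at the
    draw.\<close>
  have read: "read_known (H s k) s' k'"
    if "s' < S" "k' < m" "s' < s \<or> s' = s \<and> k' \<le> k" for s' k'
    unfolding read_known_def
  proof
    fix l assume "l \<in> {k' - \<tau>..<k'}"
    with * that have "{\<omega> \<in> space M. p \<in> U s' k' l \<omega>} \<in> sets (H s k)" for p
      by blast
    then show "simple_function (H s k) (U s' k' l)"
      by (intro simple_function_finite_set) (simp add: space)
  qed
  show "read_known (H s k) s k"
    using read s k by blast
  show "past_known (H s k) s k"
    unfolding past_known_def
  proof (intro allI impI conjI)
    fix s' k' assume "s' < S" "k' < m" and lt: "s' < s \<or> s' = s \<and> k' < k"
    with * have "ind s' k' \<in> H s k \<rightarrow>\<^sub>M count_space {1..n}" by blast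
    then show "simple_function (H s k) (ind s' k')"
      by (rule simple_function_measurable_count_space) simp
    show "read_known (H s k) s' k'"
      using \<open>s' < S\<close> \<open>k' < m\<close> lt by (intro read) auto
  qed
qed

lemma simple_M: "s < S \<Longrightarrow> k < m \<Longrightarrow> simple_function (H s k) X \<Longrightarrow> simple_function M X"
  using subalgebra_H[of s k] simple_function_subalgebra[of "H s k" X M] by (simp add: subalgebra_def)

lemma past_known_M: "past_known M s k"
  unfolding past_known_def
proof (intro allI impI conjI)
  fix s' k' assume *: "s' < S" "k' < m"
  show "simple_function M (ind s' k')"
    using ind_measurable[OF *] by (rule simple_function_measurable_count_space) simp
  show "read_known M s' k'"
    using read_known_H[OF *] simple_M[OF *] by (auto simp: read_known_def)
qed

section \<open>Measurability of iterates, read points, directions and snapshots\<close>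

lemma xr_simple:
  assumes "space N = space M" "s < S" "k < m" "read_known N s k"
    and "simple_function N (x s k)" "\<And>l. l < k \<Longrightarrow> simple_function N (v s l)"
  shows "simple_function N (xr s k)"
proof -
  have "simple_function N (\<lambda>\<omega>. unwritten_part (U s k l \<omega>) (v s l \<omega>))" if "l \<in> {k - \<tau>..<k}" for l
    using assms(4,6) that
    by (intro simple_function_compose2[where h = unwritten_part]) (auto simp: read_known_def)
  then have "simple_function N
      (\<lambda>\<omega>. x s k \<omega> + \<gamma> *\<^sub>R (\<Sum>l = k - \<tau>..<k. unwritten_part (U s k l \<omega>) (v s l \<omega>)))"
    by (intro simple_function_add simple_function_scaleR simple_function_const
        simple_function_sum assms(5))
  then show ?thesis
    using assms by (subst simple_function_cong[OF xr_eq]) auto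
qed

text \<open>The induction runs from iterate to read point, direction and next iterate. All earlier
  directions are carried along because a read reaches back over the delay window.\<close>

lemma epoch_simple:
  assumes space: "space N = space M" and s: "s < S"
    and start: "simple_function N (xt s)" "simple_function N (x s 0)"
  shows "k \<le> m \<Longrightarrow> past_known N s k \<Longrightarrow>
    simple_function N (x s k) \<and> (\<forall>l<k. simple_function N (v s l))"
proof (induction k)
  case (Suc k)
  then have k: "k < m" and past: "past_known N s k"
    by (auto intro: past_known_mono)
  have known: "simple_function N (ind s k)" "read_known N s k"
    using Suc.prems s unfolding past_known_def by auto
  have x: "simple_function N (x s k)" and v: "\<And>l. l < k \<Longrightarrow> simple_function N (v s l)"
    using Suc.IH k past by auto
  have "simple_function N (xr s k)"
    using space s k known x v by (intro xr_simple)
  \<comment> \<open>Any function of finitely valued variables is again simple, even in the random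
    index.\<close>
  then have "simple_function N (\<lambda>\<omega>. svrg_gradient n g (xt s \<omega>) (ind s k \<omega>) (xr s k \<omega>))"
    using simple_function_compose1[where g = "\<lambda>(z, i, y). svrg_gradient n g z i y",
        OF simple_function_Pair[OF start(1) simple_function_Pair[OF known(1)]]] by simp
  then have vk: "simple_function N (v s k)"
    using s k space by (subst simple_function_cong[OF v_eq]) auto
  have "simple_function N (\<lambda>\<omega>. x s k \<omega> - \<gamma> *\<^sub>R v s k \<omega>)"
    by (intro simple_function_diff simple_function_scaleR simple_function_const x vk)
  then have "simple_function N (x s (Suc k))"
    using s k space by (subst simple_function_cong[OF x_Suc]) auto
  with vk v show ?case
    by (auto simp: less_Suc_eq)
qed (use start in simp)

lemma xt_simple:
  assumes space: "space N = space M"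
  shows "s \<le> S \<Longrightarrow> past_known N s 0 \<Longrightarrow> simple_function N (xt s)"
proof (induction s)
  case 0
  then show ?case
    using space by (subst simple_function_cong[OF xt_0]) auto
next
  case (Suc s)
  \<comment> \<open>Every iteration of epoch \<open>s\<close> precedes the start of epoch
    \<open>Suc s\<close>, so its past is known for all \<open>k\<close>.\<close>
  then have s: "s < S" and past: "\<And>k. past_known N s k"
    by (auto intro: past_known_mono)
  have start: "simple_function N (xt s)"
    using Suc.IH s past by simp
  then have "simple_function N (x s 0)"
    using s space by (subst simple_function_cong[OF x_start]) auto
  with start have "simple_function N (x s k)" if "k \<in> {1..m}" for k
    using epoch_simple[OF space s] past that by simp
  then have "simple_function N (\<lambda>\<omega>. average m (\<lambda>k. x s k \<omega>))"
    by (rule simple_function_average)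
  then show ?case
    using s space by (subst simple_function_cong[OF xt_Suc]) auto
qed

lemma x_v_simple:
  assumes space: "space N = space M" and s: "s < S" and k: "k \<le> m" and past: "past_known N s k"
  shows "simple_function N (xt s)" "simple_function N (x s k)" "\<And>l. l < k \<Longrightarrow> simple_function N (v s l)"
proof -
  show xt: "simple_function N (xt s)"
    using s past by (intro xt_simple[OF space] past_known_mono[OF past]) auto
  then have "simple_function N (x s 0)"
    using s space by (subst simple_function_cong[OF x_start]) auto
  with xt show "simple_function N (x s k)" "\<And>l. l < k \<Longrightarrow> simple_function N (v s l)"
    using epoch_simple[OF space s _ _ k past] by auto
qed

lemma
  assumes s: "s < S" and k: "k < m"
  shows xt_simple_H: "simple_function (H s k) (xt s)"
    and xr_simple_H: "simple_function (H s k) (xr s k)"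
    and x_simple_H: "\<And>j. j \<le> k \<Longrightarrow> simple_function (H s k) (x s j)"
proof -
  have space: "space (H s k) = space M"
    using subalgebra_H[OF s k] by (simp add: subalgebra_def)
  note past = past_known_H[OF s k]
  show "simple_function (H s k) (xt s)"
    using s k by (intro x_v_simple(1)[OF space s _ past]) simp
  show "simple_function (H s k) (x s j)" if "j \<le> k" for j
    using that k by (intro x_v_simple(2)[OF space s]) (auto intro: past_known_mono[OF past])
  then show "simple_function (H s k) (xr s k)"
    using k by (intro xr_simple[OF space s k] read_known_H[OF s k] x_v_simple(3)[OF space s _ past]) auto
qed

lemma x_simple_M: "s < S \<Longrightarrow> k \<le> m \<Longrightarrow> simple_function M (x s k)"
  by (rule x_v_simple(2)[OF refl _ _ past_known_M])

lemma v_simple_M: "s < S \<Longrightarrow> k < m \<Longrightarrow> simple_function M (v s k)"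
  by (rule x_v_simple(3)[OF refl _ order_refl past_known_M])

lemma xt_simple_M: "s \<le> S \<Longrightarrow> simple_function M (xt s)"
  by (rule xt_simple[OF refl _ past_known_M])

lemma xr_simple_M: "s < S \<Longrightarrow> k < m \<Longrightarrow> simple_function M (xr s k)"
  by (rule simple_M[OF _ _ xr_simple_H])

section \<open>One-step inequalities in expectation\<close>

lemma expectation_sampling:
  fixes \<Phi> :: "'b \<Rightarrow> real ^ 'd \<Rightarrow> real"
  assumes s: "s < S" and k: "k < m" and X: "simple_function (H s k) X"
  shows "expectation (\<lambda>\<omega>. \<Phi> (X \<omega>) (v s k \<omega>)) =
    expectation (\<lambda>\<omega>. average n (\<lambda>i. \<Phi> (X \<omega>) (svrg_gradient n g (xt s \<omega>) i (xr s k \<omega>))))"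
proof -
  define \<Psi> where "\<Psi> i \<omega> = \<Phi> (X \<omega>) (svrg_gradient n g (xt s \<omega>) i (xr s k \<omega>))" for i \<omega>
  have \<Psi>: "simple_function (H s k) (\<Psi> i)" for i
    unfolding \<Psi>_def
    by (intro simple_function_compose2[where h = \<Phi>, OF X]
        simple_function_compose2[where h = "\<lambda>z. svrg_gradient n g z i"] xt_simple_H xr_simple_H s k)
  have "expectation (\<lambda>\<omega>. \<Phi> (X \<omega>) (v s k \<omega>)) = expectation (\<lambda>\<omega>. \<Psi> (ind s k \<omega>) \<omega>)"
    using s k by (intro Bochner_Integration.integral_cong) (auto simp: \<Psi>_def v_eq)
  \<comment> \<open>For a fixed index, \<open>\<Psi> i\<close> depends only on quantities known
    before the draw, so the independent uniform index averages out.\<close>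
  also have "\<dots> = average n (\<lambda>i. expectation (\<Psi> i))"
    using n_pos subalgebra_H[OF s k] ind_measurable[OF s k] ind_uniform[OF s k] ind_indep[OF s k] \<Psi>
    by (rule expectation_uniform_index)
  also have "\<dots> = expectation (\<lambda>\<omega>. average n (\<lambda>i. \<Psi> i \<omega>))"
    using simple_M[OF s k \<Psi>] by (intro expectation_average[symmetric])
  finally show ?thesis
    by (simp add: \<Psi>_def)
qed

text \<open>One fact for an arbitrary \<open>\<Phi>\<close> of the snapshot, iterate, read point and
  comparison point; each term of the estimates below is an instance.\<close>

lemma integrable_H:
  fixes \<Phi> :: "_ \<Rightarrow> real"
  assumes s: "s < S" and k: "k < m" and u: "simple_function (H s k) u"
  shows "integrable M (\<lambda>\<omega>. \<Phi> (xt s \<omega>, x s k \<omega>, xr s k \<omega>, u \<omega>))"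
  by (intro integrable_simple simple_M[OF s k] simple_function_compose1[where g = \<Phi>]
      simple_function_Pair xt_simple_H[OF s k] x_simple_H[OF s k order_refl] xr_simple_H[OF s k] u)

text \<open>The comparison point may be random as long as it is known before the draw, which admits
  earlier iterates besides \<open>xstar\<close>.\<close>

lemma expectation_dist_sq_step_le:
  assumes s: "s < S" and k: "k < m" and u: "simple_function (H s k) u"
  shows "expectation (\<lambda>\<omega>. (norm (x s (Suc k) \<omega> - u \<omega>))\<^sup>2) \<le>
    expectation (\<lambda>\<omega>. (norm (x s k \<omega> - u \<omega>))\<^sup>2)
    - 2 * \<gamma> * (expectation (\<lambda>\<omega>. F (x s k \<omega>) - F xstar) - expectation (\<lambda>\<omega>. F (u \<omega>) - F xstar))
    + \<gamma> * L * expectation (\<lambda>\<omega>. (norm (x s k \<omega> - xr s k \<omega>))\<^sup>2)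
    + \<gamma>\<^sup>2 * expectation (\<lambda>\<omega>. (norm (v s k \<omega>))\<^sup>2)"
proof -
  let ?sg = "\<lambda>i \<omega>. svrg_gradient n g (xt s \<omega>) i (xr s k \<omega>)"
  have x: "simple_function (H s k) (x s k)"
    by (rule x_simple_H[OF s k order_refl])
  note int = integrable_H[OF s k u]
  note integrable = int[of "\<lambda>(z, y, r, u). (norm (y - u))\<^sup>2", unfolded prod.case]
    int[of "\<lambda>(z, y, r, u). F y - F xstar", unfolded prod.case]
    int[of "\<lambda>(z, y, r, u). F u - F xstar", unfolded prod.case]
    int[of "\<lambda>(z, y, r, u). (norm (y - r))\<^sup>2", unfolded prod.case]
    int[of "\<lambda>(z, y, r, u). average n (\<lambda>i. (norm (svrg_gradient n g z i r))\<^sup>2)", unfolded prod.case]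
  have "expectation (\<lambda>\<omega>. (norm (x s (Suc k) \<omega> - u \<omega>))\<^sup>2) =
      expectation (\<lambda>\<omega>. (norm (x s k \<omega> - \<gamma> *\<^sub>R v s k \<omega> - u \<omega>))\<^sup>2)"
    using s k by (intro Bochner_Integration.integral_cong) (auto simp: x_Suc)
  also have "\<dots> = expectation (\<lambda>\<omega>. average n (\<lambda>i. (norm (x s k \<omega> - \<gamma> *\<^sub>R ?sg i \<omega> - u \<omega>))\<^sup>2))"
    using expectation_sampling[OF s k simple_function_Pair[OF x u],
        of "\<lambda>(y, z) w. (norm (y - \<gamma> *\<^sub>R w - z))\<^sup>2"] by simp
  also have "\<dots> \<le> expectation (\<lambda>\<omega>. (norm (x s k \<omega> - u \<omega>))\<^sup>2
      - 2 * \<gamma> * ((F (x s k \<omega>) - F xstar) - (F (u \<omega>) - F xstar))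
      + \<gamma> * L * (norm (x s k \<omega> - xr s k \<omega>))\<^sup>2
      + \<gamma>\<^sup>2 * average n (\<lambda>i. (norm (?sg i \<omega>))\<^sup>2))"
  proof (rule integral_mono[OF int[of "\<lambda>(z, y, r, u). average n (\<lambda>i.
        (norm (y - \<gamma> *\<^sub>R svrg_gradient n g z i r - u))\<^sup>2)", unfolded prod.case]])
    show "integrable M (\<lambda>\<omega>. (norm (x s k \<omega> - u \<omega>))\<^sup>2
        - 2 * \<gamma> * ((F (x s k \<omega>) - F xstar) - (F (u \<omega>) - F xstar))
        + \<gamma> * L * (norm (x s k \<omega> - xr s k \<omega>))\<^sup>2
        + \<gamma>\<^sup>2 * average n (\<lambda>i. (norm (?sg i \<omega>))\<^sup>2))"
      by (intro Bochner_Integration.integrable_add Bochner_Integration.integrable_diff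
          integrable_mult_right integrable)
  qed (use average_dist_sq_step_le gamma_pos in simp)
  also have "\<dots> = expectation (\<lambda>\<omega>. (norm (x s k \<omega> - u \<omega>))\<^sup>2)
      - 2 * \<gamma> * (expectation (\<lambda>\<omega>. F (x s k \<omega>) - F xstar) - expectation (\<lambda>\<omega>. F (u \<omega>) - F xstar))
      + \<gamma> * L * expectation (\<lambda>\<omega>. (norm (x s k \<omega> - xr s k \<omega>))\<^sup>2)
      + \<gamma>\<^sup>2 * expectation (\<lambda>\<omega>. average n (\<lambda>i. (norm (?sg i \<omega>))\<^sup>2))"
    by (simp only: Bochner_Integration.integral_add Bochner_Integration.integral_diff
        integral_mult_right_zero Bochner_Integration.integrable_add
        Bochner_Integration.integrable_diff integrable_mult_right integrable)
  \<comment> \<open>The sampling identity in the reverse direction restores the actual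
    update.\<close>
  also have "expectation (\<lambda>\<omega>. average n (\<lambda>i. (norm (?sg i \<omega>))\<^sup>2)) = expectation (\<lambda>\<omega>. (norm (v s k \<omega>))\<^sup>2)"
    using expectation_sampling[OF s k x, of "\<lambda>_ w. (norm w)\<^sup>2"] by simp
  finally show ?thesis .
qed

lemma expectation_F_step_le:
  assumes s: "s < S" and k: "k < m"
  shows "expectation (\<lambda>\<omega>. F (x s (Suc k) \<omega>) - F xstar) \<le>
    expectation (\<lambda>\<omega>. F (x s k \<omega>) - F xstar)
    + \<gamma> * L\<^sup>2 / 4 * expectation (\<lambda>\<omega>. (norm (x s k \<omega> - xr s k \<omega>))\<^sup>2)
    + L * \<gamma>\<^sup>2 / 2 * expectation (\<lambda>\<omega>. (norm (v s k \<omega>))\<^sup>2)"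
proof -
  let ?sg = "\<lambda>i \<omega>. svrg_gradient n g (xt s \<omega>) i (xr s k \<omega>)"
  have x: "simple_function (H s k) (x s k)"
    by (rule x_simple_H[OF s k order_refl])
  note int = integrable_H[OF s k x]
  note integrable = int[of "\<lambda>(z, y, r, u). F y - F xstar", unfolded prod.case]
    int[of "\<lambda>(z, y, r, u). (norm (y - r))\<^sup>2", unfolded prod.case]
    int[of "\<lambda>(z, y, r, u). average n (\<lambda>i. (norm (svrg_gradient n g z i r))\<^sup>2)", unfolded prod.case]
  have "expectation (\<lambda>\<omega>. F (x s (Suc k) \<omega>) - F xstar) =
      expectation (\<lambda>\<omega>. F (x s k \<omega> - \<gamma> *\<^sub>R v s k \<omega>) - F xstar)"
    using s k by (intro Bochner_Integration.integral_cong) (auto simp: x_Suc)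
  also have "\<dots> = expectation (\<lambda>\<omega>. average n (\<lambda>i. F (x s k \<omega> - \<gamma> *\<^sub>R ?sg i \<omega>) - F xstar))"
    by (rule expectation_sampling[OF s k x, of "\<lambda>y w. F (y - \<gamma> *\<^sub>R w) - F xstar"])
  also have "\<dots> \<le> expectation (\<lambda>\<omega>. (F (x s k \<omega>) - F xstar)
      + \<gamma> * L\<^sup>2 / 4 * (norm (x s k \<omega> - xr s k \<omega>))\<^sup>2
      + L * \<gamma>\<^sup>2 / 2 * average n (\<lambda>i. (norm (?sg i \<omega>))\<^sup>2))"
  proof (rule integral_mono[OF int[of "\<lambda>(z, y, r, u). average n (\<lambda>i.
        F (y - \<gamma> *\<^sub>R svrg_gradient n g z i r) - F xstar)", unfolded prod.case]])
    show "integrable M (\<lambda>\<omega>. (F (x s k \<omega>) - F xstar)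
        + \<gamma> * L\<^sup>2 / 4 * (norm (x s k \<omega> - xr s k \<omega>))\<^sup>2
        + L * \<gamma>\<^sup>2 / 2 * average n (\<lambda>i. (norm (?sg i \<omega>))\<^sup>2))"
      by (intro Bochner_Integration.integrable_add integrable_mult_right integrable)
  qed (use average_F_step_le[OF less_imp_le[OF gamma_pos]]
      in \<open>simp add: average_diff average_const[OF n_pos] add.assoc\<close>)
  also have "\<dots> = expectation (\<lambda>\<omega>. F (x s k \<omega>) - F xstar)
      + \<gamma> * L\<^sup>2 / 4 * expectation (\<lambda>\<omega>. (norm (x s k \<omega> - xr s k \<omega>))\<^sup>2)
      + L * \<gamma>\<^sup>2 / 2 * expectation (\<lambda>\<omega>. average n (\<lambda>i. (norm (?sg i \<omega>))\<^sup>2))"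
    by (simp only: Bochner_Integration.integral_add integral_mult_right_zero
        Bochner_Integration.integrable_add integrable_mult_right integrable)
  also have "expectation (\<lambda>\<omega>. average n (\<lambda>i. (norm (?sg i \<omega>))\<^sup>2)) = expectation (\<lambda>\<omega>. (norm (v s k \<omega>))\<^sup>2)"
    using expectation_sampling[OF s k x, of "\<lambda>_ w. (norm w)\<^sup>2"] by simp
  finally show ?thesis .
qed

lemma expectation_norm_v_sq_le:
  assumes s: "s < S" and k: "k < m"
  shows "expectation (\<lambda>\<omega>. (norm (v s k \<omega>))\<^sup>2) \<le>
    3 * L\<^sup>2 * expectation (\<lambda>\<omega>. (norm (x s k \<omega> - xr s k \<omega>))\<^sup>2)
    + 6 * L * (expectation (\<lambda>\<omega>. F (x s k \<omega>) - F xstar) + expectation (\<lambda>\<omega>. F (xt s \<omega>) - F xstar))"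
proof -
  have x: "simple_function (H s k) (x s k)"
    by (rule x_simple_H[OF s k order_refl])
  note int = integrable_H[OF s k x]
  note integrable = int[of "\<lambda>(z, y, r, u). F y - F xstar", unfolded prod.case]
    int[of "\<lambda>(z, y, r, u). F z - F xstar", unfolded prod.case]
    int[of "\<lambda>(z, y, r, u). (norm (y - r))\<^sup>2", unfolded prod.case]
  have "expectation (\<lambda>\<omega>. (norm (v s k \<omega>))\<^sup>2) =
      expectation (\<lambda>\<omega>. average n (\<lambda>i. (norm (svrg_gradient n g (xt s \<omega>) i (xr s k \<omega>)))\<^sup>2))"
    by (rule expectation_sampling[OF s k x, of "\<lambda>_ w. (norm w)\<^sup>2"])
  also have "\<dots> \<le> expectation (\<lambda>\<omega>. 3 * L\<^sup>2 * (norm (x s k \<omega> - xr s k \<omega>))\<^sup>2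
      + 6 * L * ((F (x s k \<omega>) - F xstar) + (F (xt s \<omega>) - F xstar)))"
    by (intro integral_mono Bochner_Integration.integrable_add integrable_mult_right integrable
        int[of "\<lambda>(z, y, r, u). average n (\<lambda>i. (norm (svrg_gradient n g z i r))\<^sup>2)", unfolded prod.case]
        average_norm_svrg_gradient_sq_le)
  also have "\<dots> = 3 * L\<^sup>2 * expectation (\<lambda>\<omega>. (norm (x s k \<omega> - xr s k \<omega>))\<^sup>2)
    + 6 * L * (expectation (\<lambda>\<omega>. F (x s k \<omega>) - F xstar) + expectation (\<lambda>\<omega>. F (xt s \<omega>) - F xstar))"
    by (simp only: Bochner_Integration.integral_add integral_mult_right_zero
        Bochner_Integration.integrable_add integrable_mult_right integrable)
  finally show ?thesis .
qed

lemma integrable_norm_v_sq: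
  assumes "s < S" "k < m"
  shows "integrable M (\<lambda>\<omega>. (norm (v s k \<omega>))\<^sup>2)"
  by (rule integrable_simple, rule simple_function_compose1[where g = "\<lambda>w. (norm w)\<^sup>2"])
    (rule v_simple_M[OF assms])

text \<open>Cauchy-Schwarz over the delay window holds for every outcome, so dependence among
  updates and read patterns is harmless.\<close>

lemma expectation_read_error_le:
  assumes s: "s < S" and k: "k < m"
  shows "expectation (\<lambda>\<omega>. (norm (x s k \<omega> - xr s k \<omega>))\<^sup>2) \<le>
    \<gamma>\<^sup>2 * real \<tau> * (\<Sum>l = k - \<tau>..<k. expectation (\<lambda>\<omega>. (norm (v s l \<omega>))\<^sup>2))"
proof -
  have v: "integrable M (\<lambda>\<omega>. (norm (v s l \<omega>))\<^sup>2)" if "l \<in> {k - \<tau>..<k}" for l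
    using that k by (intro integrable_norm_v_sq s) simp
  have "expectation (\<lambda>\<omega>. (norm (x s k \<omega> - xr s k \<omega>))\<^sup>2) \<le>
      expectation (\<lambda>\<omega>. \<gamma>\<^sup>2 * real \<tau> * (\<Sum>l = k - \<tau>..<k. (norm (v s l \<omega>))\<^sup>2))"
  proof (rule integral_mono)
    show "integrable M (\<lambda>\<omega>. (norm (x s k \<omega> - xr s k \<omega>))\<^sup>2)"
      using x_simple_M[OF s] xr_simple_M[OF s k] k
      by (intro integrable_simple simple_function_dist_sq) auto
    show "integrable M (\<lambda>\<omega>. \<gamma>\<^sup>2 * real \<tau> * (\<Sum>l = k - \<tau>..<k. (norm (v s l \<omega>))\<^sup>2))"
      by (intro integrable_mult_right Bochner_Integration.integrable_sum v)
    fix \<omega> assume \<omega>: "\<omega> \<in> space M"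
    let ?I = "\<lambda>l. unwritten_part (U s k l \<omega>) (v s l \<omega>)"
    have "(norm (x s k \<omega> - xr s k \<omega>))\<^sup>2 = \<gamma>\<^sup>2 * (norm (\<Sum>l = k - \<tau>..<k. ?I l))\<^sup>2"
      by (simp add: xr_eq[OF \<omega> s k] power_mult_distrib)
    also have "(norm (\<Sum>l = k - \<tau>..<k. ?I l))\<^sup>2 \<le>
        real (card {k - \<tau>..<k}) * (\<Sum>l = k - \<tau>..<k. (norm (?I l))\<^sup>2)"
      by (rule norm_sq_sum_le) simp
    \<comment> \<open>The window holds min(k, \<tau>) updates, and erasing coordinates does not
      lengthen a vector.\<close>
    also have "\<dots> \<le> real \<tau> * (\<Sum>l = k - \<tau>..<k. (norm (v s l \<omega>))\<^sup>2)"
      by (intro mult_mono sum_mono norm_unwritten_part_sq_le sum_nonneg) auto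
    finally show "(norm (x s k \<omega> - xr s k \<omega>))\<^sup>2 \<le> \<gamma>\<^sup>2 * real \<tau> * (\<Sum>l = k - \<tau>..<k. (norm (v s l \<omega>))\<^sup>2)"
      by (simp add: mult_left_mono mult.assoc)
  qed
  also have "\<dots> = \<gamma>\<^sup>2 * real \<tau> * (\<Sum>l = k - \<tau>..<k. expectation (\<lambda>\<omega>. (norm (v s l \<omega>))\<^sup>2))"
    by (simp only: integral_mult_right_zero Bochner_Integration.integral_sum[OF v])
  finally show ?thesis .
qed

section \<open>The potential from one snapshot to the next\<close>

definition gap :: "nat \<Rightarrow> real" where
  "gap s = expectation (\<lambda>\<omega>. F (xt s \<omega>) - F xstar)"

definition dist_sq :: "nat \<Rightarrow> real" where
  "dist_sq s = expectation (\<lambda>\<omega>. (norm (xt s \<omega> - xstar))\<^sup>2)"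

lemma gap_Suc_le:
  assumes s: "s < S"
  shows "gap (Suc s) \<le> average m (\<lambda>k. expectation (\<lambda>\<omega>. F (x s k \<omega>) - F xstar))"
proof -
  have simple: "simple_function M (\<lambda>\<omega>. F (x s k \<omega>) - F xstar)" if "k \<in> {1..m}" for k
    using simple_function_compose1[OF x_simple_M[OF s], where g = "\<lambda>y. F y - F xstar"] that by simp
  have "gap (Suc s) \<le> expectation (\<lambda>\<omega>. average m (\<lambda>k. F (x s k \<omega>) - F xstar))"
    unfolding gap_def
  proof (rule expectation_mono_simple)
    show "simple_function M (\<lambda>\<omega>. F (xt (Suc s) \<omega>) - F xstar)"
      using simple_function_compose1[OF xt_simple_M, where g = "\<lambda>y. F y - F xstar"] s by simp
    show "simple_function M (\<lambda>\<omega>. average m (\<lambda>k. F (x s k \<omega>) - F xstar))"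
      by (rule simple_function_average[OF simple])
  qed (simp add: xt_Suc s average_diff average_const[OF m_pos] F_average_le[OF m_pos])
  also have "\<dots> = average m (\<lambda>k. expectation (\<lambda>\<omega>. F (x s k \<omega>) - F xstar))"
    by (rule expectation_average[OF simple])
  finally show ?thesis .
qed

lemma dist_sq_Suc_le:
  assumes s: "s < S"
  shows "dist_sq (Suc s) \<le> average m (\<lambda>k. expectation (\<lambda>\<omega>. (norm (x s k \<omega> - xstar))\<^sup>2))"
proof -
  have simple: "simple_function M (\<lambda>\<omega>. (norm (x s k \<omega> - xstar))\<^sup>2)" if "k \<in> {1..m}" for k
    using that by (intro simple_function_dist_sq x_simple_M s simple_function_const) simp
  have "dist_sq (Suc s) \<le> expectation (\<lambda>\<omega>. average m (\<lambda>k. (norm (x s k \<omega> - xstar))\<^sup>2))"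
    unfolding dist_sq_def
  proof (rule expectation_mono_simple)
    show "simple_function M (\<lambda>\<omega>. (norm (xt (Suc s) \<omega> - xstar))\<^sup>2)"
      using s by (intro simple_function_dist_sq xt_simple_M simple_function_const) simp
    show "simple_function M (\<lambda>\<omega>. average m (\<lambda>k. (norm (x s k \<omega> - xstar))\<^sup>2))"
      by (rule simple_function_average[OF simple])
    show "(norm (xt (Suc s) \<omega> - xstar))\<^sup>2 \<le> average m (\<lambda>k. (norm (x s k \<omega> - xstar))\<^sup>2)"
      if "\<omega> \<in> space M" for \<omega>
      using norm_sq_average_le[OF m_pos, of "\<lambda>k. x s k \<omega> - xstar"]
      by (simp add: xt_Suc s that average_diff average_const[OF m_pos])
  qed
  also have "\<dots> = average m (\<lambda>k. expectation (\<lambda>\<omega>. (norm (x s k \<omega> - xstar))\<^sup>2))"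
    by (rule expectation_average[OF simple])
  finally show ?thesis .
qed

lemma gap_nonneg: "0 \<le> gap s"
  unfolding gap_def by (intro Bochner_Integration.integral_nonneg) (simp add: minimizer)

lemma epoch_le:
  assumes s: "s < S"
  shows "dist_sq (Suc s) / (2 * \<gamma> * real m) + gap (Suc s) / 10 \<le> dist_sq s / (2 * \<gamma> * real m) + gap s / 10"
    and "gap (Suc s) \<le> 21 / 20 * (dist_sq s / (2 * \<gamma> * real m) + gap s / 10)"
proof -
  define A where "A k = expectation (\<lambda>\<omega>. (norm (x s k \<omega> - xstar))\<^sup>2)" for k
  define W where "W j k = expectation (\<lambda>\<omega>. (norm (x s k \<omega> - x s j \<omega>))\<^sup>2)" for j k
  define p where "p k = expectation (\<lambda>\<omega>. F (x s k \<omega>) - F xstar)" for k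
  define B where "B k = expectation (\<lambda>\<omega>. (norm (x s k \<omega> - xr s k \<omega>))\<^sup>2)" for k
  define V where "V k = expectation (\<lambda>\<omega>. (norm (v s k \<omega>))\<^sup>2)" for k
  \<comment> \<open>Every epoch starts at its snapshot, so the distance recursion begins with the
    snapshot distance.\<close>
  have A0: "A 0 = dist_sq s"
    unfolding A_def dist_sq_def using s by (intro Bochner_Integration.integral_cong) (auto simp: x_start)
  have nonneg: "0 \<le> V k" "0 \<le> B k" "0 \<le> p k" "0 \<le> A k" "0 \<le> W j k" for j k
    unfolding V_def B_def p_def A_def W_def
    by (intro Bochner_Integration.integral_nonneg; simp add: minimizer)+
  have V: "V k \<le> 3 * L\<^sup>2 * B k + 6 * L * (p k + gap s)" if "k < m" for k
    using expectation_norm_v_sq_le[OF s that] by (simp add: V_def B_def p_def gap_def)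
  have B: "B k \<le> \<gamma>\<^sup>2 * real \<tau> * (\<Sum>l = k - \<tau>..<k. V l)" if "k < m" for k
    using expectation_read_error_le[OF s that] by (simp add: V_def B_def)
  have A: "A (Suc k) \<le> A k - 2 * \<gamma> * p k + \<gamma> * L * B k + \<gamma>\<^sup>2 * V k" if "k < m" for k
    using expectation_dist_sq_step_le[OF s that simple_function_const[of _ xstar]]
    by (simp add: A_def p_def B_def V_def)
  \<comment> \<open>The iterate at \<open>j\<close> is known before draw \<open>k\<close> because j
    \<le> k, so it is an admissible comparison point.\<close>
  have W: "W j (Suc k) \<le> W j k - 2 * \<gamma> * (p k - p j) + \<gamma> * L * B k + \<gamma>\<^sup>2 * V k" if "j \<le> k" "k < m" for j k
    using expectation_dist_sq_step_le[OF s that(2) x_simple_H[OF s that(2) that(1)]]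
    by (simp add: W_def p_def B_def V_def)
  have p: "p (Suc k) \<le> p k + \<gamma> * L\<^sup>2 / 4 * B k + L * \<gamma>\<^sup>2 / 2 * V k" if "k < m" for k
    using expectation_F_step_le[OF s that] by (simp add: p_def B_def V_def)
  have gap: "gap (Suc s) \<le> average m p" and dist: "dist_sq (Suc s) \<le> average m A"
    using gap_Suc_le[OF s] dist_sq_Suc_le[OF s] unfolding p_def A_def .
  have W0: "W j j = 0" for j
    by (simp add: W_def)
  note rec = epoch_recursion[of \<gamma> L \<tau> m V B p A W "gap s" "gap (Suc s)" "dist_sq (Suc s)",
      OF gamma_pos L_pos tau_pos m_pos step_size nonneg gap_nonneg V B A W0 W p gap dist]
  show "dist_sq (Suc s) / (2 * \<gamma> * real m) + gap (Suc s) / 10 \<le> dist_sq s / (2 * \<gamma> * real m) + gap s / 10"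
    using rec(1) by (simp add: A0)
  show "gap (Suc s) \<le> 21 / 20 * (dist_sq s / (2 * \<gamma> * real m) + gap s / 10)"
    using rec(2) by (simp add: A0)
qed

lemma potential_le:
  "s \<le> S \<Longrightarrow> dist_sq s / (2 * \<gamma> * real m) + gap s / 10 \<le>
    (norm (x00 - xstar))\<^sup>2 / (2 * \<gamma> * real m) + (F x00 - F xstar) / 10"
proof (induction s)
  case 0
  have "dist_sq 0 = expectation (\<lambda>\<omega>. (norm (x00 - xstar))\<^sup>2)" "gap 0 = expectation (\<lambda>\<omega>. F x00 - F xstar)"
    unfolding dist_sq_def gap_def by (intro Bochner_Integration.integral_cong; simp add: xt_0)+
  then show ?case
    by (simp add: prob_space)
next
  case (Suc s)
  with epoch_le(1)[of s] show ?case by simp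
qed

text \<open>The potential at the start of epoch \<open>s\<close> is at most its initial value, and
  the epoch turns it into a bound on the next gap.\<close>

lemma gap_le:
  assumes s: "s < S"
  shows "gap (Suc s) \<le> (F x00 - F xstar) + 9 / (16 * \<gamma> * real m) * (norm (x00 - xstar))\<^sup>2"
proof -
  define q where "q = (norm (x00 - xstar))\<^sup>2 / (2 * \<gamma> * real m)"
  have q: "0 \<le> q" and F: "0 \<le> F x00 - F xstar"
    using gamma_pos minimizer by (simp_all add: q_def)
  have "gap (Suc s) \<le> 21 / 20 * (q + (F x00 - F xstar) / 10)"
    unfolding q_def using epoch_le(2)[OF s] potential_le[of s] s
    by (meson less_imp_le mult_left_mono order_trans zero_le_divide_iff zero_le_numeral)
  \<comment> \<open>Here 21/20 is below 9/8 and 21/200 below 1; halving 9/8 in \<open>q\<close>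
    produces the constant 9/16.\<close>
  also have "\<dots> \<le> (F x00 - F xstar) + 9 / 8 * q"
    using q F by (simp add: field_simps)
  also have "9 / 8 * q = 9 / (16 * \<gamma> * real m) * (norm (x00 - xstar))\<^sup>2"
    by (simp add: q_def)
  finally show ?thesis .
qed

end

section \<open>The numerical step-size constant and the conclusion\<close>

lemma step_size_bound:
  fixes \<gamma> L t :: real
  assumes "L > 0" "t > 0" "\<gamma> \<le> 1 / (12 * sqrt 5 * exp 1 * (exp 1 - 1) * t\<^sup>2 * L)"
  shows "\<gamma> * L * t\<^sup>2 \<le> 1 / 100"
proof -
  have e: "5 / 2 \<le> exp (1 :: real)"
    using exp_lower_Taylor_quadratic[of "1 :: real"] by simp
  have "(223 / 100 :: real) \<le> sqrt 5"
    by (rule real_le_rsqrt) (simp add: power2_eq_square)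
  \<comment> \<open>The product of the lower bounds 2.23, 5/2 and 3/2 is 8.3625, and 12 times that
    just exceeds 100.\<close>
  with e have "223 / 100 * (5 / 2) * (3 / 2) \<le> sqrt 5 * exp 1 * (exp 1 - 1 :: real)"
    by (intro mult_mono) auto
  then have "100 \<le> 12 * (sqrt 5 * exp 1 * (exp 1 - 1 :: real))"
    by linarith
  then have C: "100 \<le> 12 * sqrt 5 * exp 1 * (exp 1 - 1 :: real)"
    by (simp only: mult.assoc)
  have "\<gamma> * L * t\<^sup>2 \<le> 1 / (12 * sqrt 5 * exp 1 * (exp 1 - 1) * t\<^sup>2 * L) * L * t\<^sup>2"
    using assms by (intro mult_right_mono) auto
  also have "\<dots> = 1 / (12 * sqrt 5 * exp 1 * (exp 1 - 1))"
    using assms by simp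
  also have "\<dots> \<le> 1 / 100"
    using C by (intro divide_left_mono) auto
  finally show ?thesis .
qed

theorem theorem5:
  fixes M :: "'w measure"
    and H :: "nat \<Rightarrow> nat \<Rightarrow> 'w measure"
    and n m \<tau> S :: nat
    and f :: "nat \<Rightarrow> real ^ 'd \<Rightarrow> real"
    and g :: "nat \<Rightarrow> real ^ 'd \<Rightarrow> real ^ 'd"
    and F :: "real ^ 'd \<Rightarrow> real"
    and L \<gamma> :: real
    and x00 xstar :: "real ^ 'd"
    and ind :: "nat \<Rightarrow> nat \<Rightarrow> 'w \<Rightarrow> nat"
    and U :: "nat \<Rightarrow> nat \<Rightarrow> nat \<Rightarrow> 'w \<Rightarrow> 'd set"
    and x xr v :: "nat \<Rightarrow> nat \<Rightarrow> 'w \<Rightarrow> real ^ 'd"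
    and xt :: "nat \<Rightarrow> 'w \<Rightarrow> real ^ 'd"
  assumes "n \<ge> 1" and "m = 2 * n" and "\<tau> \<ge> 1" and "L > 0"
    and "\<And>y. F y = average n (\<lambda>i. f i y)"
    and "\<And>i. i \<in> {1..n} \<Longrightarrow> convex_on UNIV (f i)"
    and "\<And>i y. i \<in> {1..n} \<Longrightarrow> GDERIV (f i) y :> g i y"
    and "\<And>i. i \<in> {1..n} \<Longrightarrow> L-lipschitz_on UNIV (g i)"
    and "\<And>y. F xstar \<le> F y"
    and "prob_space M"
    and "asvrg_sampling M H n \<tau> m S ind U"
    and "\<And>\<omega>. \<omega> \<in> space M \<Longrightarrow>
           asvrg_run n g \<gamma> \<tau> m S x00 (\<lambda>s k. ind s k \<omega>) (\<lambda>s k l. U s k l \<omega>)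
             (\<lambda>s k. x s k \<omega>) (\<lambda>s k. xr s k \<omega>) (\<lambda>s k. v s k \<omega>) (\<lambda>s. xt s \<omega>)"
    and "\<gamma> > 0"
    and "\<gamma> \<le> min
           (((sqrt 5 - sqrt 2) * sqrt 2) /
            (20 * 5 powr (3/4) * sqrt (exp 1) * (sqrt (exp 1) - 1) * real \<tau> * L))
           (1 / (12 * sqrt 5 * exp 1 * (exp 1 - 1) * (real \<tau>)\<^sup>2 * L))"
    and "s < S"
  shows "prob_space.expectation M (\<lambda>\<omega>. F (xt (Suc s) \<omega>) - F xstar)
           \<le> (F x00 - F xstar) + 9 / (16 * \<gamma> * real m) * (norm (x00 - xstar))\<^sup>2"
proof -
  interpret prob_space M by fact
  have "\<gamma> \<le> 1 / (12 * sqrt 5 * exp 1 * (exp 1 - 1) * (real \<tau>)\<^sup>2 * L)"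
    using assms(14) by simp
  then have step: "\<gamma> * L * (real \<tau>)\<^sup>2 \<le> 1 / 100"
    using assms(3,4) by (intro step_size_bound) auto
  interpret finite_sum n f g F L xstar
    using assms(1,4-9) by unfold_locales auto
  interpret asvrg M n f g F L xstar H \<tau> m S \<gamma> x00 ind U x xr v xt
    using assms(1-3,11-13) step by unfold_locales auto
  show ?thesis
    using gap_le[OF assms(15)] by (simp add: gap_def)
qed

end
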